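(* Let $R=\bigoplus_{n\ge 0}R_n$ be a Noetherian graded normal domain such that $R_0=K$ is a field and $\dim R\ge 2$. Suppose that the natural map $K[R_1]\hookrightarrow R$ is module-finite. Then there exists an ample Cartier divisor $D$ on $X=\operatorname{Proj}(R)$ such that $$R\cong\bigoplus_{n\ge 0}H^0(X,\mathcal{O}_X(nD))$$ as graded rings.
   Context: All rings are commutative with unit. $K[R_1]$ denotes the $K$-subalgebra of $R$ generated by the degree-one part $R_1$. The ring structure on $\bigoplus_{n\ge 0}H^0(X,\mathcal{O}_X(nD))$ is the usual one of a section ring, with multiplication induced by $\mathcal{O}_X(nD)\otimes\mathcal{O}_X(mD)\to\mathcal{O}_X((n+m)D)$, and $H^0(X,\mathcal{O}_X(nD))$ is the degree-$n$ part. *)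

theory Defs
  imports
    "HOL-Analysis.Abstract_Topology"
    "HOL-Library.Extended_Nat"
    "HOL-Algebra.Algebra"
    "HOL-Algebra.Algebraic_Closure_Type"
begin

section \<open>Commutative algebra\<close>

text \<open>The ambient ring is a type of class \<open>idom\<close>; \<open>ring_on A\<close> turns a subring of a
  type-class ring into a record, so that the notions of HOL-Algebra apply to it.
  \<open>ring_on UNIV\<close> is the ambient ring itself.\<close>

abbreviation ring_on :: "'a::comm_ring_1 set \<Rightarrow> 'a ring" where
  "ring_on A \<equiv> ring_of_type_algebra\<lparr>carrier := A\<rparr>"

definition prime_spectrum :: "'a::comm_ring_1 set \<Rightarrow> 'a set set" where
  "prime_spectrum A = {P. primeideal P (ring_on A)}"

definition krull_dim :: "('a, 'b) ring_scheme \<Rightarrow> enat" where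
  "krull_dim R = Sup {enat n |n. \<exists>P :: nat \<Rightarrow> 'a set.
     (\<forall>i\<le>n. primeideal (P i) R) \<and> (\<forall>i<n. P i \<subset> P (Suc i))}"

definition integral_over_domain :: "'a::idom fract \<Rightarrow> bool" where
  "integral_over_domain x \<longleftrightarrow>
     (\<exists>p :: 'a poly. lead_coeff p = 1 \<and> poly (map_poly (\<lambda>a. Fract a 1) p) x = 0)"

definition normal_domain :: "'a::idom itself \<Rightarrow> bool" where
  "normal_domain _ \<longleftrightarrow> (\<forall>x :: 'a fract. integral_over_domain x \<longrightarrow> x \<in> range (\<lambda>a. Fract a 1))"

definition module_finite_over :: "'a::comm_ring_1 set \<Rightarrow> bool" where
  "module_finite_over S \<longleftrightarrow> (\<exists>us :: 'a list. ring.Span (ring_on UNIV) S us = UNIV)"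

subsection \<open>Graded rings\<close>

definition graded_ring :: "(nat \<Rightarrow> 'a::comm_ring_1 set) \<Rightarrow> bool" where
  "graded_ring G \<longleftrightarrow>
     (\<forall>n. additive_subgroup (G n) (ring_on UNIV)) \<and>
     (\<forall>m n. \<forall>x\<in>G m. \<forall>y\<in>G n. x * y \<in> G (m + n)) \<and>
     (\<forall>x. \<exists>!c. (\<forall>n. c n \<in> G n) \<and> finite {n. c n \<noteq> 0} \<and> x = (\<Sum>n | c n \<noteq> 0. c n))"

definition irrelevant_ideal :: "(nat \<Rightarrow> 'a::comm_ring_1 set) \<Rightarrow> 'a set" where
  "irrelevant_ideal G = {\<Sum>n\<in>N. c n |N c. finite N \<and> 0 \<notin> N \<and> (\<forall>n\<in>N. c n \<in> G n)}"

definition homogeneous_ideal :: "(nat \<Rightarrow> 'a::comm_ring_1 set) \<Rightarrow> 'a set \<Rightarrow> bool" where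
  "homogeneous_ideal G I \<longleftrightarrow> (\<exists>H \<subseteq> (\<Union>n. G n). I = genideal (ring_on UNIV) H)"

text \<open>The subalgebra generated by the degree-one part over the degree-zero part.\<close>

definition degree_one_subalgebra :: "(nat \<Rightarrow> 'a::comm_ring_1 set) \<Rightarrow> 'a set" where
  "degree_one_subalgebra G = generate_ring (ring_on UNIV) (G 0 \<union> G 1)"


section \<open>Ringed spaces, Spec and Proj\<close>

(* Spaces are called Z, because HOL-Algebra reserves X as notation. *)

text \<open>All stalks that occur below are localizations of domains, hence subrings of one
  field \<open>'k\<close>. As in the usual construction of the structure sheaves of Spec and Proj,
  a section over \<open>U\<close> is the function assigning to each point of \<open>U\<close> the germ there.
  Sections are \<open>extensional\<close>, operations are pointwise, restriction maps are \<open>restrict\<close>.\<close>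

record ('p, 'k) ringed_space =
  top_of :: "'p topology"
  sheaf_of :: "'p set \<Rightarrow> ('p \<Rightarrow> 'k) ring"

definition function_ring :: "'p set \<Rightarrow> ('p \<Rightarrow> 'k::comm_ring_1) set \<Rightarrow> ('p \<Rightarrow> 'k) ring" where
  "function_ring U S =
     \<lparr>carrier = S,
      monoid.mult = (\<lambda>s t. \<lambda>p\<in>U. s p * t p),
      one = (\<lambda>p\<in>U. 1),
      ring.zero = (\<lambda>p\<in>U. 0),
      add = (\<lambda>s t. \<lambda>p\<in>U. s p + t p)\<rparr>"

definition zariski :: "'a::comm_ring_1 set \<Rightarrow> 'a set topology" where
  "zariski A = topology (\<lambda>U. \<exists>E\<subseteq>A. U = {P \<in> prime_spectrum A. \<not> E \<subseteq> P})"

lemma istopology_zariski: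
  "istopology (\<lambda>U. \<exists>E\<subseteq>A. U = {P \<in> prime_spectrum A. \<not> E \<subseteq> P})"
  unfolding istopology_def
proof (intro conjI allI impI)
  fix U V
  assume "\<exists>E\<subseteq>A. U = {P \<in> prime_spectrum A. \<not> E \<subseteq> P}" and "\<exists>E\<subseteq>A. V = {P \<in> prime_spectrum A. \<not> E \<subseteq> P}"
  then obtain E F where E: "E \<subseteq> A" "U = {P \<in> prime_spectrum A. \<not> E \<subseteq> P}"
    and F: "F \<subseteq> A" "V = {P \<in> prime_spectrum A. \<not> F \<subseteq> P}" by blast
  define H where "H = {e * f |e f. e \<in> E \<and> f \<in> F} \<inter> A"
  have "\<not> H \<subseteq> P \<longleftrightarrow> \<not> E \<subseteq> P \<and> \<not> F \<subseteq> P" if "P \<in> prime_spectrum A" for P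
  proof -
    interpret primeideal P "ring_on A"
      using that by (simp add: prime_spectrum_def)
    have cl: "x * y \<in> A" if "x \<in> A" "y \<in> A" for x y
      using m_closed[of x y] that by (simp add: ring_of_type_algebra_def)
    have pr: "x \<in> P \<or> y \<in> P" if "x * y \<in> P" "x \<in> A" "y \<in> A" for x y
      using I_prime[of x y] that by (simp add: ring_of_type_algebra_def)
    have l: "x * y \<in> P" if "y \<in> P" "x \<in> A" for x y
      using I_l_closed[of y x] that by (simp add: ring_of_type_algebra_def)
    have r: "x * y \<in> P" if "x \<in> P" "y \<in> A" for x y
      using I_r_closed[of x y] that by (simp add: ring_of_type_algebra_def)
    show ?thesis
    proof
      assume "\<not> H \<subseteq> P"
      then obtain e f where "e \<in> E" "f \<in> F" "e * f \<notin> P" by (auto simp: H_def)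
      then show "\<not> E \<subseteq> P \<and> \<not> F \<subseteq> P" using l r E(1) F(1) by blast
    next
      assume "\<not> E \<subseteq> P \<and> \<not> F \<subseteq> P"
      then obtain e f where ef: "e \<in> E" "f \<in> F" "e \<notin> P" "f \<notin> P" by blast
      then have "e * f \<notin> P" "e * f \<in> A" using pr cl E(1) F(1) by blast+
      then show "\<not> H \<subseteq> P" using ef by (auto simp: H_def)
    qed
  qed
  then have "U \<inter> V = {P \<in> prime_spectrum A. \<not> H \<subseteq> P}" using E F by blast
  then show "\<exists>E\<subseteq>A. U \<inter> V = {P \<in> prime_spectrum A. \<not> E \<subseteq> P}"
    by (intro exI[of _ H]) (simp add: H_def)
next
  fix \<U> :: "'a set set set"
  assume "\<forall>U\<in>\<U>. \<exists>E\<subseteq>A. U = {P \<in> prime_spectrum A. \<not> E \<subseteq> P}"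
  then obtain e where e: "\<And>U. U \<in> \<U> \<Longrightarrow> e U \<subseteq> A \<and> U = {P \<in> prime_spectrum A. \<not> e U \<subseteq> P}"
    by metis
  have "P \<in> U \<longleftrightarrow> P \<in> prime_spectrum A \<and> \<not> e U \<subseteq> P" if "U \<in> \<U>" for P U
    using e[OF that] by (metis (mono_tags, lifting) mem_Collect_eq)
  then have "\<Union>\<U> = {P \<in> prime_spectrum A. \<not> \<Union> (e ` \<U>) \<subseteq> P}"
    by (intro equalityI subsetI) (auto simp: UN_subset_iff)
  moreover have "\<Union> (e ` \<U>) \<subseteq> A" using e by blast
  ultimately show "\<exists>E\<subseteq>A. \<Union>\<U> = {P \<in> prime_spectrum A. \<not> E \<subseteq> P}" by blast
qed

definition Spec :: "'k::field set \<Rightarrow> ('k set, 'k) ringed_space" where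
  "Spec A =
     \<lparr>top_of = zariski A,
      sheaf_of = (\<lambda>U. function_ring U
        {s \<in> extensional U. \<forall>p\<in>U. \<exists>V. openin (zariski A) V \<and> p \<in> V \<and> V \<subseteq> U \<and>
           (\<exists>a\<in>A. \<exists>b\<in>A. \<forall>q\<in>V. b \<notin> q \<and> s q = a / b)})\<rparr>"

definition Proj_points :: "(nat \<Rightarrow> 'a::comm_ring_1 set) \<Rightarrow> 'a set set" where
  "Proj_points G =
     {P \<in> prime_spectrum UNIV. homogeneous_ideal G P \<and> \<not> irrelevant_ideal G \<subseteq> P}"

definition Proj_topology :: "(nat \<Rightarrow> 'a::comm_ring_1 set) \<Rightarrow> 'a set topology" where
  "Proj_topology G = subtopology (zariski UNIV) (Proj_points G)"

definition Proj :: "(nat \<Rightarrow> 'a::idom set) \<Rightarrow> ('a set, 'a fract) ringed_space" where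
  "Proj G =
     \<lparr>top_of = Proj_topology G,
      sheaf_of = (\<lambda>U. function_ring U
        {s \<in> extensional U. \<forall>p\<in>U. \<exists>V. openin (Proj_topology G) V \<and> p \<in> V \<and> V \<subseteq> U \<and>
           (\<exists>n. \<exists>a\<in>G n. \<exists>b\<in>G n. \<forall>q\<in>V. b \<notin> q \<and> s q = Fract a b)})\<rparr>"

text \<open>A germ is determined by its value, so the stalk is the set of values of sections.\<close>

definition stalk :: "('p, 'k::field) ringed_space \<Rightarrow> 'p \<Rightarrow> 'k set" where
  "stalk Z p = {s p |s U. openin (top_of Z) U \<and> p \<in> U \<and> s \<in> carrier (sheaf_of Z U)}"

definition stalk_maximal_ideal :: "('p, 'k::field) ringed_space \<Rightarrow> 'p \<Rightarrow> 'k set" where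
  "stalk_maximal_ideal Z p = {x \<in> stalk Z p. \<forall>y \<in> stalk Z p. x * y \<noteq> 1}"

definition open_subspace :: "('p, 'k) ringed_space \<Rightarrow> 'p set \<Rightarrow> ('p, 'k) ringed_space" where
  "open_subspace Z U = \<lparr>top_of = subtopology (top_of Z) U, sheaf_of = sheaf_of Z\<rparr>"

text \<open>An isomorphism of ringed spaces between locally ringed spaces is automatically local.\<close>

definition ringed_space_isomorphic ::
    "('p, 'k) ringed_space \<Rightarrow> ('q, 'l) ringed_space \<Rightarrow> bool" where
  "ringed_space_isomorphic Z W \<longleftrightarrow> (\<exists>\<phi> \<psi>.
     homeomorphic_map (top_of Z) (top_of W) \<phi> \<and>
     (\<forall>U. openin (top_of Z) U \<longrightarrow> \<psi> U \<in> ring_iso (sheaf_of Z U) (sheaf_of W (\<phi> ` U))) \<and>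
     (\<forall>U V. openin (top_of Z) U \<and> openin (top_of Z) V \<and> V \<subseteq> U \<longrightarrow>
        (\<forall>s \<in> carrier (sheaf_of Z U). \<psi> V (restrict s V) = restrict (\<psi> U s) (\<phi> ` V))))"

text \<open>For a nonempty open subset of an integral scheme the coordinate ring is a subring of the
  function field, so it suffices to let \<open>A\<close> range over the subrings of \<open>'k\<close>.\<close>

definition affine_open :: "('p, 'k::field) ringed_space \<Rightarrow> 'p set \<Rightarrow> bool" where
  "affine_open Z U \<longleftrightarrow> openin (top_of Z) U \<and>
     (\<exists>A :: 'k set. subring A (ring_on UNIV) \<and> ringed_space_isomorphic (open_subspace Z U) (Spec A))"


section \<open>Cartier divisors on an integral scheme\<close>

text \<open>The function field is the stalk at the generic point. On an integral scheme the sheaf of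
  total quotient rings is the constant sheaf with this value, i.e. the sheaf of locally constant
  functions into it.\<close>

definition function_field :: "('p, 'k::field) ringed_space \<Rightarrow> 'k set" where
  "function_field Z =
     {x. \<exists>\<eta> \<in> topspace (top_of Z). top_of Z closure_of {\<eta>} = topspace (top_of Z) \<and> x \<in> stalk Z \<eta>}"

definition rational_sections :: "('p, 'k::field) ringed_space \<Rightarrow> 'p set \<Rightarrow> ('p \<Rightarrow> 'k) set" where
  "rational_sections Z U =
     {s \<in> extensional U. \<forall>p\<in>U. \<exists>V. openin (top_of Z) V \<and> p \<in> V \<and> V \<subseteq> U \<and>
        (\<exists>g \<in> function_field Z. \<forall>q\<in>V. s q = g)}"

text \<open>A Cartier divisor is given by local data: an open cover \<open>U\<^sub>i\<close> with invertible rational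
  sections \<open>f\<^sub>i\<close> whose quotients are units of the structure sheaf on the overlaps.\<close>

definition cartier_divisor ::
    "('p, 'k::field) ringed_space \<Rightarrow> ('p set \<times> ('p \<Rightarrow> 'k)) set \<Rightarrow> bool" where
  "cartier_divisor Z D \<longleftrightarrow>
     (\<forall>(U, f) \<in> D. openin (top_of Z) U \<and> f \<in> rational_sections Z U \<and> (\<forall>p\<in>U. f p \<noteq> 0)) \<and>
     (\<Union>(U, f) \<in> D. U) = topspace (top_of Z) \<and>
     (\<forall>(U, f) \<in> D. \<forall>(V, g) \<in> D. (\<lambda>p\<in>U \<inter> V. f p / g p) \<in> Units (sheaf_of Z (U \<inter> V)))"

definition cartier_multiple ::
    "nat \<Rightarrow> ('p set \<times> ('p \<Rightarrow> 'k::field)) set \<Rightarrow> ('p set \<times> ('p \<Rightarrow> 'k)) set" where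
  "cartier_multiple n D = {(U, \<lambda>p\<in>U. f p ^ n) |U f. (U, f) \<in> D}"

text \<open>Sections over \<open>V\<close> of the invertible sheaf of \<open>D\<close>: the submodule of the sheaf of rational
  functions generated by the inverse of \<open>f\<close> on \<open>U\<close>, for each \<open>(U, f) \<in> D\<close>.\<close>

definition divisor_sections ::
    "('p, 'k::field) ringed_space \<Rightarrow> ('p set \<times> ('p \<Rightarrow> 'k)) set \<Rightarrow> 'p set \<Rightarrow> ('p \<Rightarrow> 'k) set" where
  "divisor_sections Z D V =
     {s \<in> rational_sections Z V.
        \<forall>(U, f) \<in> D. (\<lambda>p\<in>U \<inter> V. s p * f p) \<in> carrier (sheaf_of Z (U \<inter> V))}"

abbreviation global_sections ::
    "('p, 'k::field) ringed_space \<Rightarrow> ('p set \<times> ('p \<Rightarrow> 'k)) set \<Rightarrow> ('p \<Rightarrow> 'k) set" where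
  "global_sections Z D \<equiv> divisor_sections Z D (topspace (top_of Z))"

definition divisor_stalk ::
    "('p, 'k::field) ringed_space \<Rightarrow> ('p set \<times> ('p \<Rightarrow> 'k)) set \<Rightarrow> 'p \<Rightarrow> 'k set" where
  "divisor_stalk Z D p =
     {s p |s V. openin (top_of Z) V \<and> p \<in> V \<and> s \<in> divisor_sections Z D V}"

text \<open>The set \<open>Z\<^sub>s\<close> of points where the germ of \<open>s\<close> is not in the maximal ideal times the stalk.\<close>

definition nonvanishing_locus ::
    "('p, 'k::field) ringed_space \<Rightarrow> ('p set \<times> ('p \<Rightarrow> 'k)) set \<Rightarrow> ('p \<Rightarrow> 'k) \<Rightarrow> 'p set" where
  "nonvanishing_locus Z D s =
     {p \<in> topspace (top_of Z).
        s p \<notin> {a * b |a b. a \<in> stalk_maximal_ideal Z p \<and> b \<in> divisor_stalk Z D p}}"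

text \<open>Ampleness in the sense of EGA II, 4.5 and the Stacks project.\<close>

definition ample :: "('p, 'k::field) ringed_space \<Rightarrow> ('p set \<times> ('p \<Rightarrow> 'k)) set \<Rightarrow> bool" where
  "ample Z D \<longleftrightarrow> compact_space (top_of Z) \<and>
     (\<forall>p \<in> topspace (top_of Z). \<exists>n\<ge>1. \<exists>s \<in> global_sections Z (cartier_multiple n D).
        p \<in> nonvanishing_locus Z (cartier_multiple n D) s \<and>
        affine_open Z (nonvanishing_locus Z (cartier_multiple n D) s))"

text \<open>The direct sum of the global sections of all multiples: finitely supported families,
  multiplied by convolution.\<close>

definition section_ring ::
    "('p, 'k::field) ringed_space \<Rightarrow> ('p set \<times> ('p \<Rightarrow> 'k)) set \<Rightarrow> (nat \<Rightarrow> 'p \<Rightarrow> 'k) ring" where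
  "section_ring Z D = (let T = topspace (top_of Z) in
     \<lparr>carrier = {c. (\<forall>n. c n \<in> global_sections Z (cartier_multiple n D)) \<and>
                    finite {n. c n \<noteq> (\<lambda>p\<in>T. 0)}},
      monoid.mult = (\<lambda>c d n. \<lambda>p\<in>T. \<Sum>i\<le>n. c i p * d (n - i) p),
      one = (\<lambda>n. \<lambda>p\<in>T. if n = 0 then 1 else 0),
      ring.zero = (\<lambda>n. \<lambda>p\<in>T. 0),
      add = (\<lambda>c d n. \<lambda>p\<in>T. c n p + d n p)\<rparr>)"

definition section_ring_degree ::
    "('p, 'k::field) ringed_space \<Rightarrow> ('p set \<times> ('p \<Rightarrow> 'k)) set \<Rightarrow> nat \<Rightarrow> (nat \<Rightarrow> 'p \<Rightarrow> 'k) set" where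
  "section_ring_degree Z D n =
     {c \<in> carrier (section_ring Z D). \<forall>m. m \<noteq> n \<longrightarrow> c m = (\<lambda>p \<in> topspace (top_of Z). 0)}"

end

theory Submission
  imports Defs
begin

text \<open>
  Let \<open>x \<in> G 1\<close> be nonzero. The divisor \<open>D\<close> is the hyperplane section \<open>x = 0\<close>, given on the open set
  \<open>y \<noteq> 0\<close> by the function \<open>x / y\<close>, for each nonzero \<open>y \<in> G 1\<close>. Sending \<open>r \<in> G n\<close> to the rational function
  \<open>r / x\<^sup>n\<close> identifies the Serre twist \<open>\<O>(n)\<close> with the sheaf of \<open>n D\<close>, and the family of these maps is
  the isomorphism of the theorem. Three points need an argument.

  \<^item> The sets \<open>y \<noteq> 0\<close> cover Proj, so that \<open>D\<close> is a Cartier divisor. This is where finiteness over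
    the subalgebra generated in degree one enters: modulo a homogeneous prime containing \<open>G 1\<close> that
    subalgebra becomes \<open>G 0\<close>, so the ring has no elements of large degree modulo this prime
    (\<open>degree_one_notin_Proj_point\<close>).

  \<^item> The set \<open>y \<noteq> 0\<close> is the nonvanishing locus of the section \<open>y / x\<close> of \<open>D\<close>, and it is the spectrum of the
    ring of fractions \<open>a / y\<^sup>k\<close> with \<open>a \<in> G k\<close>; therefore \<open>D\<close> is ample
    (\<open>affine_open_basic_open\<close>, \<open>nonvanishing_locus_degree_one\<close>).

  \<^item> There are no further sections. Proj is irreducible, so a global section of \<open>n D\<close> is a constant
    rational function \<open>g\<close>, and \<open>h = g x\<^sup>n\<close> is a homogeneous fraction which locally on Proj has a
    denominator that does not vanish. Such an \<open>h\<close> lies in the ring (\<open>in_ring_if_locally_in_ring\<close>). Otherwise,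
    the ring being Noetherian, some homogeneous multiple \<open>h'\<close> of \<open>h\<close> outside the ring is multiplied into
    the ring exactly by the elements of the irrelevant ideal \<open>M\<close>. If \<open>h' M \<subseteq> M\<close>, then \<open>h'\<close> is integral over
    the ring, contradicting normality. If not, then \<open>M\<close> is principal, the ring is a polynomial ring in one
    variable, and its dimension is at most one.
\<close>

section \<open>Ideals of subrings of a type-class ring\<close>

lemma ring_of_type_algebra_sel [simp]:
  "carrier ring_of_type_algebra = UNIV" "x \<otimes>\<^bsub>ring_of_type_algebra\<^esub> y = x * y"
  "x \<oplus>\<^bsub>ring_of_type_algebra\<^esub> y = x + y"
  "\<one>\<^bsub>ring_of_type_algebra\<^esub> = 1" "\<zero>\<^bsub>ring_of_type_algebra\<^esub> = 0"
  by (simp_all add: ring_of_type_algebra_def)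

definition subring_closed :: "'a::comm_ring_1 set \<Rightarrow> bool" where
  "subring_closed A \<longleftrightarrow> 1 \<in> A \<and> (\<forall>a\<in>A. \<forall>b\<in>A. a + b \<in> A) \<and>
     (\<forall>a\<in>A. \<forall>b\<in>A. a * b \<in> A) \<and> (\<forall>a\<in>A. - a \<in> A)"

lemma subring_closed_UNIV [simp]: "subring_closed UNIV"
  by (simp add: subring_closed_def)

lemma subring_closed_zero: "subring_closed A \<Longrightarrow> 0 \<in> A"
  unfolding subring_closed_def by (metis add.right_inverse)

lemma cring_ring_on:
  assumes "subring_closed A"
  shows "cring (ring_on A)"
proof -
  have z: "0 \<in> A" using subring_closed_zero[OF assms] .
  show ?thesis
    using assms z unfolding subring_closed_def
    by unfold_locales (auto simp: algebra_simps Units_def intro: add.right_inverse)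
qed

lemma ring_ring_on: "subring_closed A \<Longrightarrow> ring (ring_on A)"
  using cring_ring_on cring.axioms(1) by blast

lemma uminus_ring_on:
  assumes "subring_closed A" "x \<in> A"
  shows "\<ominus>\<^bsub>ring_on A\<^esub> x = - x"
proof -
  interpret cring "ring_on A" by (rule cring_ring_on[OF assms(1)])
  have "- x \<in> A" using assms by (auto simp: subring_closed_def)
  then show ?thesis using minus_equality[of "- x" x] assms by simp
qed

lemma ideal_ring_on_iff:
  assumes "subring_closed A"
  shows "ideal I (ring_on A) \<longleftrightarrow>
    I \<subseteq> A \<and> 0 \<in> I \<and> (\<forall>a\<in>I. \<forall>b\<in>I. a + b \<in> I) \<and> (\<forall>a\<in>A. \<forall>b\<in>I. a * b \<in> I)"
proof
  assume "ideal I (ring_on A)"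
  then interpret ideal I "ring_on A" .
  show "I \<subseteq> A \<and> 0 \<in> I \<and> (\<forall>a\<in>I. \<forall>b\<in>I. a + b \<in> I) \<and> (\<forall>a\<in>A. \<forall>b\<in>I. a * b \<in> I)"
    using a_subset additive_subgroup.zero_closed[OF additive_subgroup_axioms]
      additive_subgroup.a_closed[OF additive_subgroup_axioms] I_l_closed by auto
next
  assume *: "I \<subseteq> A \<and> 0 \<in> I \<and> (\<forall>a\<in>I. \<forall>b\<in>I. a + b \<in> I) \<and> (\<forall>a\<in>A. \<forall>b\<in>I. a * b \<in> I)"
  interpret cring "ring_on A" by (rule cring_ring_on[OF assms])
  have neg: "- a \<in> I" if "a \<in> I" for a
  proof -
    have "- 1 \<in> A" using assms by (auto simp: subring_closed_def)
    then have "(- 1) * a \<in> I" using * that by blast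
    then show ?thesis by simp
  qed
  have sub: "subgroup I (add_monoid (ring_on A))"
  proof (rule group.subgroupI[OF a_group])
    show "I \<subseteq> carrier (add_monoid (ring_on A))" "I \<noteq> {}" using * by auto
    fix a assume a: "a \<in> I"
    have "inv\<^bsub>add_monoid (ring_on A)\<^esub> a = - a"
      using uminus_ring_on[OF assms, of a] a * by (auto simp: a_inv_def)
    then show "inv\<^bsub>add_monoid (ring_on A)\<^esub> a \<in> I" using neg[OF a] by simp
    fix b assume "b \<in> I"
    then show "a \<otimes>\<^bsub>add_monoid (ring_on A)\<^esub> b \<in> I" using a * by simp
  qed
  have "a * x \<in> I" "x * a \<in> I" if "a \<in> I" "x \<in> A" for a x
    using * that by (metis mult.commute)+
  then show "ideal I (ring_on A)"
    by (intro idealI[OF local.ring_axioms sub]) simp_all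
qed

lemma prime_spectrum_iff:
  assumes "subring_closed A"
  shows "P \<in> prime_spectrum A \<longleftrightarrow> ideal P (ring_on A) \<and> 1 \<notin> P \<and>
    (\<forall>a\<in>A. \<forall>b\<in>A. a * b \<in> P \<longrightarrow> a \<in> P \<or> b \<in> P)"
proof
  assume "P \<in> prime_spectrum A"
  then interpret primeideal P "ring_on A" by (simp add: prime_spectrum_def)
  have "1 \<notin> P"
    using one_imp_carrier I_notcarr by auto
  then show "ideal P (ring_on A) \<and> 1 \<notin> P \<and>
    (\<forall>a\<in>A. \<forall>b\<in>A. a * b \<in> P \<longrightarrow> a \<in> P \<or> b \<in> P)"
    using I_prime ideal_axioms by auto
next
  assume *: "ideal P (ring_on A) \<and> 1 \<notin> P \<and> (\<forall>a\<in>A. \<forall>b\<in>A. a * b \<in> P \<longrightarrow> a \<in> P \<or> b \<in> P)"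
  show "P \<in> prime_spectrum A"
    unfolding prime_spectrum_def mem_Collect_eq
    using * assms by (intro primeidealI cring_ring_on) (auto simp: subring_closed_def)
qed

lemma subring_if_subring_closed:
  assumes "subring_closed A"
  shows "subring A (ring_on UNIV)"
proof (rule ring.subringI[OF ring_ring_on])
  fix h assume "h \<in> A"
  then show "\<ominus>\<^bsub>ring_on UNIV\<^esub> h \<in> A"
    using assms by (simp add: uminus_ring_on subring_closed_def)
qed (use assms in \<open>auto simp: subring_closed_def\<close>)

lemma openin_zariski: "openin (zariski A) U \<longleftrightarrow> (\<exists>E\<subseteq>A. U = {P \<in> prime_spectrum A. \<not> E \<subseteq> P})"
  unfolding zariski_def by (simp add: topology_inverse'[OF istopology_zariski])

abbreviation "ideal_UNIV I \<equiv> ideal I (ring_on UNIV)"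

lemma
  assumes "ideal_UNIV I"
  shows ideal_zero: "0 \<in> I"
    and ideal_add: "a \<in> I \<Longrightarrow> b \<in> I \<Longrightarrow> a + b \<in> I"
    and ideal_mult: "b \<in> I \<Longrightarrow> c * b \<in> I"
  using assms by (auto simp: ideal_ring_on_iff)

lemma ideal_mult_right: "ideal_UNIV I \<Longrightarrow> b \<in> I \<Longrightarrow> b * c \<in> I"
  using ideal_mult[of I b c] by (simp add: mult.commute)

lemma ideal_uminus: "ideal_UNIV I \<Longrightarrow> b \<in> I \<Longrightarrow> - b \<in> I"
  using ideal_mult[of I b "- 1"] by simp

lemma ideal_diff: "ideal_UNIV I \<Longrightarrow> a \<in> I \<Longrightarrow> b \<in> I \<Longrightarrow> a - b \<in> I"
  using ideal_add[of I a "- b"] ideal_uminus[of I b] by simp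

lemma ideal_sum: "ideal_UNIV I \<Longrightarrow> (\<And>i. i \<in> N \<Longrightarrow> f i \<in> I) \<Longrightarrow> sum f N \<in> I"
  by (induction N rule: infinite_finite_induct) (auto intro: ideal_zero ideal_add)

lemma prime_power:
  assumes "P \<in> prime_spectrum UNIV" "a ^ k \<in> P"
  shows "a \<in> P"
  using assms(2) by (induction k) (use assms(1) in \<open>auto simp: prime_spectrum_iff\<close>)

lemma genideal_ideal: "ideal_UNIV (genideal (ring_on UNIV) H)"
  by (rule ring.genideal_ideal[OF ring_ring_on]) auto

lemma genideal_incl: "H \<subseteq> genideal (ring_on UNIV) H"
  unfolding genideal_def by blast

lemma genideal_least: "ideal_UNIV I \<Longrightarrow> H \<subseteq> I \<Longrightarrow> genideal (ring_on UNIV) H \<subseteq> I"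
  unfolding genideal_def by blast

subsection \<open>The ascending chain condition\<close>

lemma maximal_ideal_in_family:
  assumes "noetherian_ring (ring_on (UNIV :: 'a::comm_ring_1 set))"
    and "F \<noteq> {}" and "\<And>I. I \<in> F \<Longrightarrow> ideal_UNIV (I :: 'a set)"
  obtains M where "M \<in> F" "\<And>I. I \<in> F \<Longrightarrow> M \<subseteq> I \<Longrightarrow> I = M"
proof -
  have "\<exists>M\<in>F. \<forall>I\<in>F. M \<subseteq> I \<longrightarrow> I = M"
  proof (rule subset_Zorn_nonempty[OF assms(2)])
    fix C assume C: "C \<noteq> {}" "subset.chain F C"
    then have "subset.chain {I. ideal_UNIV I} C"
      using assms(3) by (auto simp: subset_chain_def)
    then have "\<Union>C \<in> C" by (rule noetherian_ring.ideal_chain_is_trivial[OF assms(1) C(1)])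
    then show "\<Union>C \<in> F" using C(2) by (auto simp: subset_chain_def)
  qed
  then show ?thesis using that by blast
qed

text \<open>That the finitely many generators can be chosen from the given set \<open>E\<close> is what makes Proj
  quasi-compact: open subsets of Proj are given by sets \<open>E\<close> of ring elements, and a union of open
  sets by the union of these sets.\<close>

lemma finite_generating_subset:
  assumes "noetherian_ring (ring_on (UNIV :: 'a::comm_ring_1 set))"
  obtains F where "finite F" "F \<subseteq> E" "\<And>I. ideal_UNIV (I :: 'a set) \<Longrightarrow> F \<subseteq> I \<Longrightarrow> E \<subseteq> I"
proof -
  obtain M where M: "M \<in> genideal (ring_on UNIV) ` {F. finite F \<and> F \<subseteq> E}"
    and max: "\<And>I. I \<in> genideal (ring_on UNIV) ` {F. finite F \<and> F \<subseteq> E} \<Longrightarrow> M \<subseteq> I \<Longrightarrow> I = M"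
    by (rule maximal_ideal_in_family[OF assms, of "genideal (ring_on UNIV) ` {F. finite F \<and> F \<subseteq> E}"])
      (use genideal_ideal in auto)
  then obtain F where F: "finite F" "F \<subseteq> E" "M = genideal (ring_on UNIV) F" by blast
  have "e \<in> M" if "e \<in> E" for e
  proof -
    have "genideal (ring_on UNIV) (insert e F) = M"
    proof (rule max)
      show "genideal (ring_on UNIV) (insert e F) \<in> genideal (ring_on UNIV) ` {F. finite F \<and> F \<subseteq> E}"
        using F(1,2) that by blast
      show "M \<subseteq> genideal (ring_on UNIV) (insert e F)"
        unfolding F(3) using genideal_incl[of "insert e F"] by (intro genideal_least genideal_ideal) auto
    qed
    then show ?thesis using genideal_incl[of "insert e F"] by blast
  qed
  then have "E \<subseteq> I" if "ideal_UNIV I" "F \<subseteq> I" for I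
    using genideal_least[OF that] F(3) by blast
  then show ?thesis using F that by blast
qed

text \<open>An element with a common denominator for all its powers is integral: the ideals
  \<open>c (1, h, \<dots>, h\<^sup>k)\<close> form a stationary chain.\<close>

lemma integral_if_bounded_denominators:
  fixes h :: "'a::idom fract"
  assumes noeth: "noetherian_ring (ring_on (UNIV :: 'a set))"
    and c: "c \<noteq> 0" and bounded: "\<And>k. to_fract c * h ^ k \<in> range to_fract"
  shows "integral_over_domain h"
proof -
  define J where "J k = {r. \<exists>a. to_fract r = (\<Sum>i<k. to_fract (a i) * (to_fract c * h ^ i))}" for k
  have idl: "ideal_UNIV (J k)" for k
  proof -
    have "0 \<in> J k" by (auto simp: J_def intro!: exI[of _ "\<lambda>_. 0"])
    moreover have "r + s \<in> J k" if rs: "r \<in> J k" "s \<in> J k" for r s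
    proof -
      from rs obtain a b where "to_fract r = (\<Sum>i<k. to_fract (a i) * (to_fract c * h ^ i))"
        "to_fract s = (\<Sum>i<k. to_fract (b i) * (to_fract c * h ^ i))" by (auto simp: J_def)
      then have "to_fract (r + s) = (\<Sum>i<k. to_fract (a i + b i) * (to_fract c * h ^ i))"
        by (simp add: sum.distrib distrib_right)
      then show ?thesis unfolding J_def by (intro CollectI exI)
    qed
    moreover have "r * s \<in> J k" if s: "s \<in> J k" for r s
    proof -
      from s obtain a where "to_fract s = (\<Sum>i<k. to_fract (a i) * (to_fract c * h ^ i))"
        by (auto simp: J_def)
      then have "to_fract (r * s) = (\<Sum>i<k. to_fract (r * a i) * (to_fract c * h ^ i))"
        by (simp add: sum_distrib_left mult.assoc)
      then show ?thesis unfolding J_def by (intro CollectI exI)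
    qed
    ultimately show ?thesis by (simp add: ideal_ring_on_iff)
  qed
  obtain M where M: "M \<in> range J" and max: "\<And>I. I \<in> range J \<Longrightarrow> M \<subseteq> I \<Longrightarrow> I = M"
    by (rule maximal_ideal_in_family[OF noeth, of "range J"]) (use idl in auto)
  then obtain K where K: "M = J K" by blast
  have "J K \<subseteq> J (Suc K)"
  proof
    fix r assume "r \<in> J K"
    then obtain a where a: "to_fract r = (\<Sum>i<K. to_fract (a i) * (to_fract c * h ^ i))"
      by (auto simp: J_def)
    then have "to_fract r = (\<Sum>i<Suc K. to_fract ((a(K := 0)) i) * (to_fract c * h ^ i))"
      by simp
    then show "r \<in> J (Suc K)" unfolding J_def by blast
  qed
  then have JK: "J (Suc K) = J K" using max[of "J (Suc K)"] K by auto
  obtain r where r: "to_fract r = to_fract c * h ^ K" using bounded[of K] by auto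
  have "to_fract r = (\<Sum>i<Suc K. to_fract (if i = K then 1 else 0) * (to_fract c * h ^ i))"
    using r by simp
  then have "r \<in> J (Suc K)" unfolding J_def by (intro CollectI exI)
  then have "r \<in> J K" unfolding JK .
  then obtain a where a: "to_fract c * h ^ K = (\<Sum>i<K. to_fract (a i) * (to_fract c * h ^ i))"
    using r by (auto simp: J_def)
  also have "\<dots> = to_fract c * (\<Sum>i<K. to_fract (a i) * h ^ i)"
    by (simp add: sum_distrib_left mult_ac)
  finally have hK: "h ^ K = (\<Sum>i<K. to_fract (a i) * h ^ i)" using c by simp
  have "K \<noteq> 0" using hK by (metis lessThan_0 power_0 sum.empty zero_neq_one)
  define q where "q = (\<Sum>i<K. monom (a i) i)"
  have "degree q < K"
    unfolding q_def using \<open>K \<noteq> 0\<close>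
    by (intro degree_sum_less) (auto intro: le_less_trans[OF degree_monom_le])
  have cK: "coeff (monom 1 K - q) K = 1"
    using coeff_eq_0[OF \<open>degree q < K\<close>] by simp
  have "degree (monom 1 K - q) = K"
  proof (rule antisym)
    show "degree (monom 1 K - q) \<le> K"
      using \<open>degree q < K\<close> by (intro degree_diff_le degree_monom_le) simp
    show "K \<le> degree (monom 1 K - q)" using cK le_degree[of "monom 1 K - q" K] by (metis one_neq_zero)
  qed
  then have lc: "lead_coeff (monom 1 K - q) = 1" using cK by simp
  have fq: "fract_poly q = (\<Sum>i<K. monom (to_fract (a i)) i)"
    unfolding q_def by (induction K) (simp_all add: map_poly_monom)
  have "poly (fract_poly (monom 1 K - q)) h = h ^ K - (\<Sum>i<K. to_fract (a i) * h ^ i)"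
    by (simp add: map_poly_monom fq poly_monom poly_sum)
  then have "poly (fract_poly (monom 1 K - q)) h = 0" using hK by simp
  moreover have "fract_poly = map_poly (\<lambda>a::'a. Fract a 1)"
    by (simp add: to_fract_def[abs_def])
  ultimately show ?thesis unfolding integral_over_domain_def using lc by metis
qed

section \<open>Graded domains over a field\<close>

locale graded_domain =
  fixes G :: "nat \<Rightarrow> 'a::idom set"
  assumes graded: "graded_ring G"
    and subfield_0: "subfield (G 0) (ring_on UNIV)"
begin

lemma additive_G: "additive_subgroup (G n) (ring_on UNIV)"
  using graded by (simp add: graded_ring_def)

lemma G_zero [simp, intro]: "0 \<in> G n"
  using additive_subgroup.zero_closed[OF additive_G[of n]] by simp

lemma G_add [intro]: "x \<in> G n \<Longrightarrow> y \<in> G n \<Longrightarrow> x + y \<in> G n"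
  using additive_subgroup.a_closed[OF additive_G[of n]] by simp

lemma G_uminus [intro]: "x \<in> G n \<Longrightarrow> - x \<in> G n"
  using additive_subgroup.a_inv_closed[OF additive_G[of n], of x]
  by (simp add: uminus_ring_on)

lemma G_mult: "x \<in> G m \<Longrightarrow> y \<in> G n \<Longrightarrow> x * y \<in> G (m + n)"
  using graded by (simp add: graded_ring_def)

lemma G_mult': "x \<in> G m \<Longrightarrow> y \<in> G n \<Longrightarrow> k = m + n \<Longrightarrow> x * y \<in> G k"
  using G_mult by simp

lemma G_one [simp, intro]: "1 \<in> G 0"
proof -
  interpret subfield "G 0" "ring_on UNIV" by (rule subfield_0)
  show ?thesis using one_closed by simp
qed

lemma G_0_inverse:
  assumes "c \<in> G 0" "c \<noteq> 0"
  obtains d where "d \<in> G 0" "c * d = 1"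
proof -
  interpret subfield "G 0" "ring_on UNIV" by (rule subfield_0)
  have "c \<in> Units (ring_on (G 0))" using subfield_Units assms by simp
  then show ?thesis using that unfolding Units_def by auto
qed

lemma G_power: "y \<in> G m \<Longrightarrow> y ^ k \<in> G (k * m)"
  by (induction k) (auto intro: G_mult)

lemma G1_power: "y \<in> G 1 \<Longrightarrow> y ^ k \<in> G k"
  using G_power[of y 1 k] by simp

subsection \<open>Homogeneous components\<close>

definition component :: "nat \<Rightarrow> 'a \<Rightarrow> 'a" where
  "component n x = (THE c. (\<forall>n. c n \<in> G n) \<and> finite {n. c n \<noteq> 0} \<and> x = (\<Sum>n | c n \<noteq> 0. c n)) n"

lemma component_props: "(\<forall>n. component n x \<in> G n) \<and> finite {n. component n x \<noteq> 0} \<and> x = (\<Sum>n | component n x \<noteq> 0. component n x)"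
proof -
  have "\<exists>!c. (\<forall>n. c n \<in> G n) \<and> finite {n. c n \<noteq> 0} \<and> x = (\<Sum>n | c n \<noteq> 0. c n)"
    using graded unfolding graded_ring_def by blast
  from theI'[OF this] show ?thesis unfolding component_def .
qed

lemma component_in [simp, intro]: "component n x \<in> G n"
  using component_props by blast

lemma finite_comp: "finite {n. component n x \<noteq> 0}"
  using component_props by blast

lemma sum_comp_support: "(\<Sum>n | component n x \<noteq> 0. component n x) = x"
  using component_props[of x] by metis

lemma sum_comp: "finite N \<Longrightarrow> {n. component n x \<noteq> 0} \<subseteq> N \<Longrightarrow> x = (\<Sum>n\<in>N. component n x)"
  by (subst sum_comp_support[symmetric], rule sum.mono_neutral_left) auto

lemma component_bound: obtains M where "\<And>n. n \<ge> M \<Longrightarrow> component n x = 0"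
proof -
  obtain M where "\<forall>n\<in>{n. component n x \<noteq> 0}. n < M"
    using finite_comp finite_nat_set_iff_bounded by blast
  then show ?thesis using that[of M] by fastforce
qed

lemma sum_comp_lessThan: "(\<And>n. n \<ge> M \<Longrightarrow> component n x = 0) \<Longrightarrow> x = (\<Sum>n<M. component n x)"
  by (rule sum_comp) (auto intro: leI)

lemma component_unique:
  assumes "\<And>n. c n \<in> G n" "finite N" "\<And>n. n \<notin> N \<Longrightarrow> c n = 0" "x = (\<Sum>n\<in>N. c n)"
  shows "component n x = c n"
proof -
  define Q where "Q d \<longleftrightarrow> (\<forall>n. d n \<in> G n) \<and> finite {n. d n \<noteq> 0} \<and> x = (\<Sum>n | d n \<noteq> 0. d n)" for d
  have ex1: "\<exists>!d. Q d"
    using graded unfolding graded_ring_def Q_def by blast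
  have sub: "{n. c n \<noteq> 0} \<subseteq> N" using assms(3) by blast
  have "x = (\<Sum>n | c n \<noteq> 0. c n)"
    unfolding assms(4) by (rule sum.mono_neutral_right) (use assms sub in auto)
  then have "Q c" unfolding Q_def using assms(1) finite_subset[OF sub assms(2)] by blast
  moreover have "Q (\<lambda>n. component n x)" unfolding Q_def by (rule component_props)
  ultimately have "(\<lambda>n. component n x) = c" using ex1 by blast
  then show ?thesis by metis
qed

lemma component_homogeneous: "x \<in> G m \<Longrightarrow> component n x = (if n = m then x else 0)"
  by (rule component_unique[of _ "{m}"]) auto

lemma component_zero [simp]: "component n 0 = 0"
  using component_homogeneous[of 0 n n] by simp

lemma component_add: "component n (x + y) = component n x + component n y"
proof (rule component_unique[of _ "{n. component n x \<noteq> 0} \<union> {n. component n y \<noteq> 0}"])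
  let ?N = "{n. component n x \<noteq> 0} \<union> {n. component n y \<noteq> 0}"
  have "x = (\<Sum>n\<in>?N. component n x)" "y = (\<Sum>n\<in>?N. component n y)"
    by (rule sum_comp; use finite_comp in blast)+
  then show "x + y = (\<Sum>n\<in>?N. component n x + component n y)" unfolding sum.distrib by presburger
qed (use finite_comp in auto)

lemma component_uminus: "component n (- x) = - component n x"
  using component_add[of n x "- x"] by (simp add: add_eq_0_iff)

lemma component_diff: "component n (x - y) = component n x - component n y"
  using component_add[of n x "- y"] by (simp add: component_uminus)

lemma component_sum: "component n (sum f N) = (\<Sum>i\<in>N. component n (f i))"
  by (induction N rule: infinite_finite_induct) (auto simp: component_add)

lemma component_mult_homogeneous:
  assumes "y \<in> G m"
  shows "component n (x * y) = (if m \<le> n then component (n - m) x * y else 0)"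
proof (rule component_unique[of _ "(\<lambda>i. i + m) ` {i. component i x \<noteq> 0}"])
  fix n show "(if m \<le> n then component (n - m) x * y else 0) \<in> G n"
    using G_mult[OF component_in assms, of "n - m" x] by auto
  assume "n \<notin> (\<lambda>i. i + m) ` {i. component i x \<noteq> 0}"
  then have "component (n - m) x = 0" if "m \<le> n"
    using that by (auto simp: image_iff dest!: spec[of _ "n - m"])
  then show "(if m \<le> n then component (n - m) x * y else 0) = 0" by simp
next
  have "x * y = (\<Sum>i | component i x \<noteq> 0. component i x) * y" by (simp add: sum_comp_support)
  then show "x * y = (\<Sum>n\<in>(\<lambda>i. i + m) ` {i. component i x \<noteq> 0}. if m \<le> n then component (n - m) x * y else 0)"
    by (simp add: sum_distrib_right sum.reindex inj_on_def)
qed (use finite_comp in auto)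

lemma component_homogeneous_mult:
  "y \<in> G m \<Longrightarrow> component n (y * x) = (if m \<le> n then y * component (n - m) x else 0)"
  using component_mult_homogeneous[of y m n x] by (simp add: mult.commute)

lemma component_mult: "component n (x * y) = (\<Sum>i\<le>n. component i x * component (n - i) y)"
proof -
  obtain M where M: "\<And>k. k \<ge> M \<Longrightarrow> component k x = 0" using component_bound by blast
  have "x * y = (\<Sum>i<M. component i x) * y" using sum_comp_lessThan[OF M] by metis
  also have "\<dots> = (\<Sum>i<M. component i x * y)" by (simp add: sum_distrib_right)
  finally have "component n (x * y) = (\<Sum>i<M. if i \<le> n then component i x * component (n - i) y else 0)"
    by (simp add: component_sum component_homogeneous_mult[OF component_in])
  also have "\<dots> = (\<Sum>i\<in>{..<M} \<inter> {..n}. component i x * component (n - i) y)"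
    by (subst sum.inter_restrict) (auto intro!: sum.cong)
  also have "\<dots> = (\<Sum>i\<le>n. component i x * component (n - i) y)"
    by (rule sum.mono_neutral_left) (use M leI in auto)
  finally show ?thesis .
qed

lemma eq_0_if_comp_0: "(\<And>n. component n x = 0) \<Longrightarrow> x = 0"
  using sum_comp_support[of x] by simp

lemma component_eqI: "(\<And>n. component n x = component n y) \<Longrightarrow> x = y"
  using eq_0_if_comp_0[of "x - y"] by (simp add: component_diff)

lemma homogeneous_if_comp: "(\<And>n. n \<noteq> m \<Longrightarrow> component n x = 0) \<Longrightarrow> x \<in> G m"
proof -
  assume "\<And>n. n \<noteq> m \<Longrightarrow> component n x = 0"
  then have "x = (\<Sum>n\<in>{m}. component n x)" by (intro sum_comp) auto
  then show "x \<in> G m" by (metis component_in sum.insert[of "{}" m "\<lambda>n. component n x"] add_0_right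
        finite.emptyI empty_iff sum.empty)
qed

subsection \<open>Homogeneous ideals\<close>

lemma homogeneous_ideal_iff:
  assumes "ideal_UNIV I"
  shows "homogeneous_ideal G I \<longleftrightarrow> (\<forall>x\<in>I. \<forall>n. component n x \<in> I)"
proof
  assume "homogeneous_ideal G I"
  then obtain H where H: "H \<subseteq> (\<Union>n. G n)" "I = genideal (ring_on UNIV) H"
    by (auto simp: homogeneous_ideal_def)
  have "ideal_UNIV {x. \<forall>n. component n x \<in> I}"
    by (auto simp: ideal_ring_on_iff component_add component_mult
        intro!: ideal_sum[OF assms] ideal_mult[OF assms] ideal_zero[OF assms] ideal_add[OF assms])
  moreover have "H \<subseteq> {x. \<forall>n. component n x \<in> I}"
    using H genideal_incl[of H] ideal_zero[OF assms] by (fastforce simp: component_homogeneous)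
  ultimately have "I \<subseteq> {x. \<forall>n. component n x \<in> I}" using genideal_least H(2) by blast
  then show "\<forall>x\<in>I. \<forall>n. component n x \<in> I" by blast
next
  assume cl: "\<forall>x\<in>I. \<forall>n. component n x \<in> I"
  let ?H = "I \<inter> (\<Union>n. G n)"
  have "x \<in> genideal (ring_on UNIV) ?H" if "x \<in> I" for x
  proof -
    have "component n x \<in> genideal (ring_on UNIV) ?H" for n
      using cl that genideal_incl[of ?H] by blast
    then have "(\<Sum>n | component n x \<noteq> 0. component n x) \<in> genideal (ring_on UNIV) ?H"
      by (intro ideal_sum genideal_ideal)
    then show ?thesis by (simp add: sum_comp_support)
  qed
  then have "I = genideal (ring_on UNIV) ?H"
    using genideal_least[OF assms, of ?H] by blast
  then show "homogeneous_ideal G I" unfolding homogeneous_ideal_def by blast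
qed

lemma irrelevant_subset_iff:
  assumes "ideal_UNIV I"
  shows "irrelevant_ideal G \<subseteq> I \<longleftrightarrow> (\<forall>n>0. G n \<subseteq> I)"
proof
  assume I: "irrelevant_ideal G \<subseteq> I"
  have "a \<in> irrelevant_ideal G" if "a \<in> G n" "n > 0" for a n
    unfolding irrelevant_ideal_def mem_Collect_eq
    by (rule exI[of _ "{n}"], rule exI[of _ "\<lambda>_. a"]) (use that in simp)
  then show "\<forall>n>0. G n \<subseteq> I" using I by blast
next
  assume I: "\<forall>n>0. G n \<subseteq> I"
  show "irrelevant_ideal G \<subseteq> I"
  proof
    fix x assume "x \<in> irrelevant_ideal G"
    then obtain N c where "finite N" "0 \<notin> N" "\<forall>n\<in>N. c n \<in> G n" and x: "x = (\<Sum>n\<in>N. c n)"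
      unfolding irrelevant_ideal_def by blast
    then have "\<forall>n\<in>N. c n \<in> I" using I by (metis gr0I subsetD)
    then show "x \<in> I" unfolding x by (intro ideal_sum[OF assms]) blast
  qed
qed

text \<open>For a homogeneous ideal it suffices to test primality on homogeneous elements: if neither
  factor lies in the ideal, the product of their lowest components outside the ideal is the only
  term of a component of the product that is not known to lie in it.\<close>

lemma prime_if_homogeneously_prime:
  assumes I: "ideal_UNIV I" and cl: "\<And>x n. x \<in> I \<Longrightarrow> component n x \<in> I" and one: "1 \<notin> I"
    and pr: "\<And>m n a b. a \<in> G m \<Longrightarrow> b \<in> G n \<Longrightarrow> a * b \<in> I \<Longrightarrow> a \<in> I \<or> b \<in> I"
  shows "I \<in> prime_spectrum UNIV"
proof -
  have ex: "\<exists>n. component n a \<notin> I" if "a \<notin> I" for a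
    using that ideal_sum[OF I, of "{n. component n a \<noteq> 0}" "\<lambda>n. component n a"] by (auto simp: sum_comp_support)
  have "a \<in> I \<or> b \<in> I" if ab: "a * b \<in> I" for a b
  proof (rule ccontr)
    assume "\<not> (a \<in> I \<or> b \<in> I)"
    then have "a \<notin> I" "b \<notin> I" by auto
    define i where "i = (LEAST i. component i a \<notin> I)"
    define j where "j = (LEAST j. component j b \<notin> I)"
    have i: "component i a \<notin> I" "\<And>k. k < i \<Longrightarrow> component k a \<in> I"
      unfolding i_def using LeastI_ex[OF ex[OF \<open>a \<notin> I\<close>]] not_less_Least by blast+
    have j: "component j b \<notin> I" "\<And>k. k < j \<Longrightarrow> component k b \<in> I"
      unfolding j_def using LeastI_ex[OF ex[OF \<open>b \<notin> I\<close>]] not_less_Least by blast+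
    let ?rest = "\<Sum>k\<in>{..i + j} - {i}. component k a * component (i + j - k) b"
    have "component (i + j) (a * b) = component i a * component j b + ?rest"
      unfolding component_mult by (subst sum.remove[of _ i]) auto
    then have "component i a * component j b = component (i + j) (a * b) - ?rest" by simp
    moreover have "?rest \<in> I"
    proof (rule ideal_sum[OF I])
      fix k assume "k \<in> {..i + j} - {i}"
      then consider "k < i" | "i + j - k < j" by fastforce
      then show "component k a * component (i + j - k) b \<in> I"
        using i(2) j(2) ideal_mult[OF I] ideal_mult_right[OF I] by cases blast+
    qed
    ultimately have "component i a * component j b \<in> I"
      using ideal_diff[OF I cl[OF ab, of "i + j"]] by simp
    then show False using pr[OF component_in component_in] i(1) j(1) by blast
  qed
  then show ?thesis
    unfolding prime_spectrum_iff[OF subring_closed_UNIV] using I one by blast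
qed

lemma Proj_points_iff:
  "P \<in> Proj_points G \<longleftrightarrow> P \<in> prime_spectrum UNIV \<and> (\<forall>x\<in>P. \<forall>n. component n x \<in> P) \<and>
     (\<exists>n>0. \<exists>a\<in>G n. a \<notin> P)"
proof (cases "P \<in> prime_spectrum UNIV")
  case True
  then have I: "ideal_UNIV P" by (simp add: prime_spectrum_iff)
  show ?thesis
    unfolding Proj_points_def mem_Collect_eq homogeneous_ideal_iff[OF I] irrelevant_subset_iff[OF I]
    by blast
qed (simp add: Proj_points_def)

lemma
  assumes "P \<in> Proj_points G"
  shows Proj_ideal: "ideal_UNIV P"
    and Proj_one: "1 \<notin> P"
    and Proj_prime: "a * b \<in> P \<Longrightarrow> a \<in> P \<or> b \<in> P"
    and Proj_comp: "x \<in> P \<Longrightarrow> component n x \<in> P"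
    and Proj_spec: "P \<in> prime_spectrum UNIV"
  using assms by (auto simp: Proj_points_iff prime_spectrum_iff)

lemma Proj_zero: "P \<in> Proj_points G \<Longrightarrow> 0 \<in> P"
  using ideal_zero Proj_ideal by blast

lemma Proj_power: "P \<in> Proj_points G \<Longrightarrow> a ^ k \<in> P \<Longrightarrow> a \<in> P"
  using prime_power Proj_spec by blast

lemma Proj_mult_notin: "P \<in> Proj_points G \<Longrightarrow> a \<notin> P \<Longrightarrow> b \<notin> P \<Longrightarrow> a * b \<notin> P"
  using Proj_prime by blast

lemma zero_in_Proj_points:
  assumes "x \<in> G n" "n > 0" "x \<noteq> 0"
  shows "{0} \<in> Proj_points G"
  using assms by (auto simp: Proj_points_iff prime_spectrum_iff ideal_ring_on_iff)

subsection \<open>Topology and structure sheaf of Proj\<close>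

lemma openin_Proj:
  "openin (Proj_topology G) U \<longleftrightarrow> (\<exists>E. U = {P \<in> Proj_points G. \<not> E \<subseteq> P})"
  unfolding Proj_topology_def openin_subtopology openin_zariski
proof
  assume "\<exists>T. (\<exists>E\<subseteq>UNIV. T = {P \<in> prime_spectrum UNIV. \<not> E \<subseteq> P}) \<and> U = T \<inter> Proj_points G"
  then obtain E where "U = {P \<in> prime_spectrum UNIV. \<not> E \<subseteq> P} \<inter> Proj_points G" by blast
  then have "U = {P \<in> Proj_points G. \<not> E \<subseteq> P}" using Proj_spec by blast
  then show "\<exists>E. U = {P \<in> Proj_points G. \<not> E \<subseteq> P}" by blast
next
  assume "\<exists>E. U = {P \<in> Proj_points G. \<not> E \<subseteq> P}"
  then obtain E where "U = {P \<in> Proj_points G. \<not> E \<subseteq> P}" by blast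
  then have "U = {P \<in> prime_spectrum UNIV. \<not> E \<subseteq> P} \<inter> Proj_points G" using Proj_spec by blast
  then show "\<exists>T. (\<exists>E\<subseteq>UNIV. T = {P \<in> prime_spectrum UNIV. \<not> E \<subseteq> P}) \<and> U = T \<inter> Proj_points G"
    by blast
qed

lemma topspace_Proj [simp]: "topspace (Proj_topology G) = Proj_points G"
proof
  show "topspace (Proj_topology G) \<subseteq> Proj_points G"
    by (simp add: Proj_topology_def topspace_subtopology)
  have "openin (Proj_topology G) (Proj_points G)"
    unfolding openin_Proj using Proj_one by (intro exI[of _ UNIV]) auto
  then show "Proj_points G \<subseteq> topspace (Proj_topology G)" by (rule openin_subset)
qed

lemma top_of_Proj [simp]: "top_of (Proj G) = Proj_topology G"
  by (simp add: Proj_def)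

definition basic_open :: "'a \<Rightarrow> 'a set set" where
  "basic_open y = {P \<in> Proj_points G. y \<notin> P}"

lemma openin_basic_open [simp]: "openin (Proj_topology G) (basic_open y)"
  unfolding openin_Proj basic_open_def by (intro exI[of _ "{y}"]) auto

lemma generic_in_open: "openin (Proj_topology G) U \<Longrightarrow> {0} \<in> Proj_points G \<Longrightarrow> P \<in> U \<Longrightarrow> {0} \<in> U"
proof -
  assume *: "openin (Proj_topology G) U" "{0} \<in> Proj_points G" "P \<in> U"
  then obtain E where E: "U = {P \<in> Proj_points G. \<not> E \<subseteq> P}" unfolding openin_Proj by blast
  then have "\<not> E \<subseteq> P" "0 \<in> P" using * Proj_zero by blast+
  then have "\<not> E \<subseteq> {0}" by blast
  then show "{0} \<in> U" using E * by blast
qed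

lemma closure_generic:
  assumes "{0} \<in> Proj_points G"
  shows "Proj_topology G closure_of {{0}} = Proj_points G"
  using generic_in_open[OF _ assms] by (auto simp: in_closure_of)

definition Proj_sections :: "'a set set \<Rightarrow> ('a set \<Rightarrow> 'a fract) set" where
  "Proj_sections U = {s \<in> extensional U. \<forall>p\<in>U. \<exists>V. openin (Proj_topology G) V \<and> p \<in> V \<and> V \<subseteq> U \<and>
     (\<exists>n. \<exists>a\<in>G n. \<exists>b\<in>G n. \<forall>q\<in>V. b \<notin> q \<and> s q = Fract a b)}"

lemma sheaf_of_Proj: "sheaf_of (Proj G) U = function_ring U (Proj_sections U)"
  by (simp add: Proj_def Proj_sections_def)

lemma carrier_sheaf_of_Proj [simp]: "carrier (sheaf_of (Proj G) U) = Proj_sections U"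
  by (simp add: sheaf_of_Proj function_ring_def)

lemma global_fraction_in_Proj_sections:
  assumes "openin (Proj_topology G) U" "a \<in> G n" "b \<in> G n" "\<And>q. q \<in> U \<Longrightarrow> b \<notin> q"
    "s \<in> extensional U" "\<And>q. q \<in> U \<Longrightarrow> s q = Fract a b"
  shows "s \<in> Proj_sections U"
proof -
  have "\<forall>q\<in>U. b \<notin> q \<and> s q = Fract a b" using assms by simp
  then show ?thesis
    unfolding Proj_sections_def using assms(1-3,5) by (intro CollectI conjI ballI exI[of _ U]) blast+
qed

lemma Proj_sections_value:
  assumes "s \<in> Proj_sections U" "p \<in> U"
  obtains n a b where "a \<in> G n" "b \<in> G n" "b \<notin> p" "s p = Fract a b"
proof -
  obtain V n a b where "p \<in> V" "a \<in> G n" "b \<in> G n" "\<forall>q\<in>V. b \<notin> q \<and> s q = Fract a b"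
    using assms unfolding Proj_sections_def by fast
  then show ?thesis using that by blast
qed

lemma stalk_ProjE:
  assumes "u \<in> stalk (Proj G) p"
  obtains n a b where "a \<in> G n" "b \<in> G n" "b \<notin> p" "u = Fract a b"
  using assms unfolding stalk_def by (auto elim: Proj_sections_value)

lemma stalk_ProjI:
  assumes "p \<in> Proj_points G" "a \<in> G n" "b \<in> G n" "b \<notin> p"
  shows "Fract a b \<in> stalk (Proj G) p"
proof -
  have "(\<lambda>q\<in>basic_open b. Fract a b) \<in> Proj_sections (basic_open b)"
    by (rule global_fraction_in_Proj_sections[OF openin_basic_open assms(2,3)]) (auto simp: basic_open_def)
  moreover have "p \<in> basic_open b" using assms by (simp add: basic_open_def)
  ultimately show ?thesis
    unfolding stalk_def mem_Collect_eq
    by (intro exI[of _ "\<lambda>q\<in>basic_open b. Fract a b"] exI[of _ "basic_open b"]) simp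
qed

lemma function_field_ProjE:
  assumes "u \<in> function_field (Proj G)"
  obtains n a b where "a \<in> G n" "b \<in> G n" "b \<noteq> 0" "u = Fract a b"
proof -
  obtain \<eta> where "\<eta> \<in> Proj_points G" "u \<in> stalk (Proj G) \<eta>"
    using assms by (auto simp: function_field_def)
  then show ?thesis using stalk_ProjE[of u \<eta>] Proj_zero[of \<eta>] that by metis
qed

lemma function_field_ProjI:
  assumes "{0} \<in> Proj_points G" "a \<in> G n" "b \<in> G n" "b \<noteq> 0"
  shows "Fract a b \<in> function_field (Proj G)"
  unfolding function_field_def using assms closure_generic[OF assms(1)]
  by (auto intro!: bexI[of _ "{0}"] stalk_ProjI)

lemma compact_space_Proj:
  assumes "noetherian_ring (ring_on (UNIV :: 'a set))"
  shows "compact_space (Proj_topology G)"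
  unfolding compact_space_alt
proof (intro allI impI)
  fix \<U> assume *: "(\<forall>U\<in>\<U>. openin (Proj_topology G) U) \<and> topspace (Proj_topology G) \<subseteq> \<Union>\<U>"
  then have "\<forall>U\<in>\<U>. \<exists>E. U = {P \<in> Proj_points G. \<not> E \<subseteq> P}" by (simp add: openin_Proj)
  then obtain e where e: "\<And>U. U \<in> \<U> \<Longrightarrow> U = {P \<in> Proj_points G. \<not> e U \<subseteq> P}" by metis
  obtain F where F: "finite F" "F \<subseteq> \<Union> (e ` \<U>)"
    "\<And>I. ideal_UNIV I \<Longrightarrow> F \<subseteq> I \<Longrightarrow> \<Union> (e ` \<U>) \<subseteq> I"
    using finite_generating_subset[OF assms, of "\<Union> (e ` \<U>)"] by blast
  then obtain \<F> where \<F>: "finite \<F>" "\<F> \<subseteq> \<U>" "F \<subseteq> \<Union> (e ` \<F>)"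
    using finite_subset_Union[of F "e ` \<U>"] by (metis finite_subset_image)
  have "P \<in> \<Union>\<F>" if P: "P \<in> Proj_points G" for P
  proof -
    obtain U where "U \<in> \<U>" "P \<in> U" using * P by auto
    then have "\<not> e U \<subseteq> P" using e by blast
    then have "\<not> F \<subseteq> P" using F(3)[OF Proj_ideal[OF P]] \<open>U \<in> \<U>\<close> by blast
    then obtain W where "W \<in> \<F>" "\<not> e W \<subseteq> P" using \<F>(3) by blast
    then have "P \<in> W" using e[of W] P \<F>(2) by blast
    then show ?thesis using \<open>W \<in> \<F>\<close> by blast
  qed
  then show "\<exists>\<F>. finite \<F> \<and> \<F> \<subseteq> \<U> \<and> topspace (Proj_topology G) \<subseteq> \<Union> \<F>"
    using \<F> by auto
qed

end

section \<open>The standard opens of degree one cover Proj\<close>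

context graded_domain
begin

text \<open>Modulo a homogeneous ideal \<open>I\<close> containing \<open>G 1\<close>, the subalgebra generated by \<open>G 1\<close> is just
  \<open>G 0\<close>. A ring that is module-finite over it is therefore, modulo \<open>I\<close>, spanned over \<open>G 0\<close> by
  finitely many elements, and these have components in boundedly many degrees only.\<close>

lemma degree_one_subalgebra_mod_ideal:
  assumes I: "ideal_UNIV I" and "G 1 \<subseteq> I" and "s \<in> degree_one_subalgebra G"
  shows "\<exists>c\<in>G 0. s - c \<in> I"
  using assms(3) unfolding degree_one_subalgebra_def
proof (induction rule: generate_ring.induct)
  case one
  then show ?case using ideal_zero[OF I] by (intro bexI[of _ 1]) auto
next
  case (incl h)
  then show ?case
  proof
    assume "h \<in> G 0"
    then show ?thesis using ideal_zero[OF I] by (intro bexI[of _ h]) auto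
  next
    assume "h \<in> G 1"
    then show ?thesis using assms(2) by (intro bexI[of _ 0]) auto
  qed
next
  case (a_inv h)
  then obtain c where "c \<in> G 0" "h - c \<in> I" by blast
  then show ?case using ideal_uminus[OF I, of "h - c"]
    by (intro bexI[of _ "- c"]) (auto simp: uminus_ring_on)
next
  case (eng_add g h)
  then obtain c d where "c \<in> G 0" "g - c \<in> I" "d \<in> G 0" "h - d \<in> I" by blast
  then show ?case using ideal_add[OF I, of "g - c" "h - d"]
    by (intro bexI[of _ "c + d"]) (auto simp: algebra_simps)
next
  case (eng_mult g h)
  then obtain c d where cd: "c \<in> G 0" "g - c \<in> I" "d \<in> G 0" "h - d \<in> I" by blast
  have "g * h - c * d = h * (g - c) + c * (h - d)" by (simp add: algebra_simps)
  then have "g * h - c * d \<in> I" using cd ideal_add[OF I] ideal_mult[OF I] by metis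
  then show ?case using G_mult[OF cd(1,3)] by (intro bexI[of _ "c * d"]) auto
qed

lemma Span_mod_ideal:
  assumes I: "ideal_UNIV I" and "G 1 \<subseteq> I"
    and "r \<in> ring.Span (ring_on UNIV) (degree_one_subalgebra G) us"
    and "\<And>u n. u \<in> set us \<Longrightarrow> n \<ge> M \<Longrightarrow> component n u = 0"
  shows "\<exists>v. r - v \<in> I \<and> (\<forall>n\<ge>M. component n v = 0)"
  using assms(3,4)
proof (induction us arbitrary: r)
  case Nil
  then have "r = 0" by (simp add: ring.Span.simps[OF ring_ring_on])
  then show ?case using ideal_zero[OF I] by (intro exI[of _ 0]) auto
next
  case (Cons u us)
  from Cons.prems(1) obtain s t where st: "s \<in> degree_one_subalgebra G"
    "t \<in> ring.Span (ring_on UNIV) (degree_one_subalgebra G) us" "r = s * u + t"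
    by (auto simp: ring.Span.simps[OF ring_ring_on] ring.line_extension_mem_iff[OF ring_ring_on])
  obtain c where c: "c \<in> G 0" "s - c \<in> I"
    using degree_one_subalgebra_mod_ideal[OF I assms(2) st(1)] by blast
  obtain v where v: "t - v \<in> I" "\<forall>n\<ge>M. component n v = 0" using Cons.IH[OF st(2)] Cons.prems(2) by auto
  have "r - (c * u + v) = u * (s - c) + (t - v)" using st(3) by (simp add: algebra_simps)
  then have "r - (c * u + v) \<in> I" using c v ideal_add[OF I] ideal_mult[OF I] by metis
  moreover have "component n (c * u + v) = 0" if "n \<ge> M" for n
    using that v(2) Cons.prems(2)[of u n] by (simp add: component_add component_homogeneous_mult[OF c(1)])
  ultimately show ?case by blast
qed

lemma high_degree_in_ideal:
  assumes fin: "module_finite_over (degree_one_subalgebra G)"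
    and I: "ideal_UNIV I" and cl: "\<And>x n. x \<in> I \<Longrightarrow> component n x \<in> I" and "G 1 \<subseteq> I"
  obtains M where "\<And>n. n \<ge> M \<Longrightarrow> G n \<subseteq> I"
proof -
  obtain us where us: "ring.Span (ring_on UNIV) (degree_one_subalgebra G) us = (UNIV :: 'a set)"
    using fin by (auto simp: module_finite_over_def)
  have "\<exists>M. \<forall>u\<in>set us. \<forall>n\<ge>M. component n u = 0"
  proof (induction us)
    case (Cons u us)
    then obtain M where M: "\<forall>u\<in>set us. \<forall>n\<ge>M. component n u = 0" by blast
    obtain N where "\<And>n. n \<ge> N \<Longrightarrow> component n u = 0" using component_bound by blast
    then show ?case using M by (intro exI[of _ "max M N"]) auto
  qed simp
  then obtain M where M: "\<And>u n. u \<in> set us \<Longrightarrow> n \<ge> M \<Longrightarrow> component n u = 0" by blast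
  have "r \<in> I" if r: "r \<in> G n" "n \<ge> M" for r n
  proof -
    obtain v where v: "r - v \<in> I" "\<forall>n\<ge>M. component n v = 0"
      using Span_mod_ideal[OF I assms(4), of r us M] M us by blast
    then have "component n (r - v) = r" using r by (simp add: component_diff component_homogeneous)
    then show ?thesis using cl[OF v(1), of n] by simp
  qed
  then show ?thesis using that by blast
qed

text \<open>A homogeneous prime containing \<open>G 1\<close> contains all powers of large degree of each
  homogeneous element of positive degree, and so the element itself.\<close>

lemma degree_one_in_prime_imp_irrelevant:
  assumes fin: "module_finite_over (degree_one_subalgebra G)"
    and P: "P \<in> prime_spectrum UNIV" and cl: "\<And>x n. x \<in> P \<Longrightarrow> component n x \<in> P" and G1: "G 1 \<subseteq> P"
    and a: "a \<in> G n" "n > 0"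
  shows "a \<in> P"
proof -
  have I: "ideal_UNIV P" using P by (simp add: prime_spectrum_iff)
  obtain M where M: "\<And>n. n \<ge> M \<Longrightarrow> G n \<subseteq> P" using high_degree_in_ideal[OF fin I cl G1] by blast
  have "M \<le> M * n" using a(2) by simp
  then have "a ^ M \<in> P" using M G_power[OF a(1), of M] by blast
  then show ?thesis using prime_power[OF P] by blast
qed

lemma degree_one_notin_Proj_point:
  assumes "module_finite_over (degree_one_subalgebra G)" and P: "P \<in> Proj_points G"
  obtains y where "y \<in> G 1" "y \<notin> P"
proof -
  have "\<not> G 1 \<subseteq> P"
    using degree_one_in_prime_imp_irrelevant[OF assms(1) Proj_spec[OF P] Proj_comp[OF P]] P
    by (auto simp: Proj_points_iff)
  then show ?thesis using that by blast
qed

section \<open>Graded domains of dimension at least two\<close>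

lemma prime_chain_if_dim_ge_2:
  assumes "2 \<le> krull_dim (ring_on (UNIV :: 'a set))"
  obtains P\<^sub>0 P\<^sub>1 P\<^sub>2 :: "'a set" where "P\<^sub>1 \<in> prime_spectrum UNIV" "P\<^sub>2 \<in> prime_spectrum UNIV"
    "P\<^sub>0 \<in> prime_spectrum UNIV" "P\<^sub>0 \<subset> P\<^sub>1" "P\<^sub>1 \<subset> P\<^sub>2"
proof -
  let ?S = "{enat n |n. \<exists>P :: nat \<Rightarrow> 'a set.
     (\<forall>i\<le>n. primeideal (P i) (ring_on UNIV)) \<and> (\<forall>i<n. P i \<subset> P (Suc i))}"
  have "\<exists>n P. n \<ge> 2 \<and> (\<forall>i\<le>n. primeideal (P i :: 'a set) (ring_on UNIV)) \<and> (\<forall>i<n. P i \<subset> P (Suc i))"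
  proof (rule ccontr)
    assume neg: "\<not> ?thesis"
    have "Sup ?S \<le> enat 1"
    proof (rule Sup_least)
      fix e assume "e \<in> ?S"
      then obtain n where n: "e = enat n" "\<exists>P :: nat \<Rightarrow> 'a set.
        (\<forall>i\<le>n. primeideal (P i) (ring_on UNIV)) \<and> (\<forall>i<n. P i \<subset> P (Suc i))" by blast
      then have "\<not> n \<ge> 2" using neg by blast
      then show "e \<le> enat 1" using n(1) by simp
    qed
    then have "2 \<le> enat 1" using assms unfolding krull_dim_def by (rule order_trans[rotated])
    then show False by (simp add: numeral_eq_enat)
  qed
  then obtain n and P :: "nat \<Rightarrow> 'a set" where P: "n \<ge> 2" "\<forall>i\<le>n. primeideal (P i) (ring_on UNIV)"
    "\<forall>i<n. P i \<subset> P (Suc i)" by blast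
  have "P 0 \<subset> P 1" "P 1 \<subset> P 2" using P(1,3) by (auto simp: numeral_2_eq_2)
  then show ?thesis using that[of "P 1" "P 2" "P 0"] P(1,2) by (simp add: prime_spectrum_def)
qed

text \<open>Otherwise the zero ideal is a homogeneous prime containing \<open>G 1\<close>. Then there are no elements of
  positive degree, the ring is the field \<open>G 0\<close>, and its dimension is zero.\<close>

lemma degree_one_nontrivial:
  assumes fin: "module_finite_over (degree_one_subalgebra G)"
    and dim: "2 \<le> krull_dim (ring_on (UNIV :: 'a set))"
  obtains x where "x \<in> G 1" "x \<noteq> 0"
proof -
  have "\<exists>x\<in>G 1. x \<noteq> 0"
  proof (rule ccontr)
    assume "\<not> ?thesis"
    then have G1: "G 1 \<subseteq> {0}" by blast
    have "{0::'a} \<in> prime_spectrum UNIV" by (auto simp: prime_spectrum_iff ideal_ring_on_iff)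
    then have pos: "a = 0" if "a \<in> G n" "n > 0" for a n
      using degree_one_in_prime_imp_irrelevant[OF fin _ _ G1 that] by auto
    have G0: "r \<in> G 0" for r by (rule homogeneous_if_comp) (use pos component_in in blast)
    obtain P\<^sub>0 P\<^sub>1 P\<^sub>2 :: "'a set" where P: "P\<^sub>1 \<in> prime_spectrum UNIV" "P\<^sub>0 \<in> prime_spectrum UNIV"
      "P\<^sub>0 \<subset> P\<^sub>1" by (rule prime_chain_if_dim_ge_2[OF dim])
    then obtain c where c: "c \<in> P\<^sub>1" "c \<notin> P\<^sub>0" by blast
    moreover have "0 \<in> P\<^sub>0" using P(2) ideal_zero by (auto simp: prime_spectrum_iff)
    ultimately obtain d where "c * d = 1" using G_0_inverse[OF G0, of c] by metis
    then have "1 \<in> P\<^sub>1" using ideal_mult_right[of P\<^sub>1 c d] c(1) P(1) by (simp add: prime_spectrum_iff)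
    then show False using P(1) by (simp add: prime_spectrum_iff)
  qed
  then show ?thesis using that by blast
qed

text \<open>If the irrelevant ideal is principal, dividing repeatedly by its generator \<open>u\<close> writes each
  homogeneous element as a constant times a power of \<open>u\<close>, as in a polynomial ring in one variable.\<close>

lemma homogeneous_eq_power_if_principal:
  assumes u: "u \<in> G d" "d > 0" and dvd: "\<forall>n>0. \<forall>r\<in>G n. u dvd r"
    and "r \<in> G n" "r \<noteq> 0"
  shows "\<exists>c\<in>G 0. \<exists>i. r = c * u ^ i \<and> n = d * i"
  using assms(4,5)
proof (induction n arbitrary: r rule: less_induct)
  case (less n)
  show ?case
  proof (cases "n = 0")
    case True
    then show ?thesis using less.prems by (intro bexI[of _ r] exI[of _ 0]) auto
  next
    case False
    then have "u dvd r" using dvd less.prems(1) by blast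
    then obtain s where s: "r = u * s" by (rule dvdE)
    have "r = component n r" using less.prems by (simp add: component_homogeneous)
    also have "\<dots> = (if d \<le> n then u * component (n - d) s else 0)"
      unfolding s by (rule component_homogeneous_mult[OF u(1)])
    finally have r: "d \<le> n" "r = u * component (n - d) s" using less.prems(2) by (auto split: if_splits)
    then obtain c i where "c \<in> G 0" "component (n - d) s = c * u ^ i" "n - d = d * i"
      using less.IH[of "n - d" "component (n - d) s"] less.prems(2) u(2) \<open>n \<noteq> 0\<close> by auto
    then show ?thesis using r by (intro bexI[of _ c] exI[of _ "Suc i"]) auto
  qed
qed

lemma homogeneous_dvd_if_principal:
  assumes u: "u \<in> G d" "d > 0" and dvd: "\<forall>n>0. \<forall>r\<in>G n. u dvd r"
    and "r \<in> G m" "s \<in> G n" "s \<noteq> 0" "n \<le> m"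
  shows "\<exists>t\<in>G (m - n). r = s * t"
proof (cases "r = 0")
  case False
  obtain c i where c: "c \<in> G 0" "r = c * u ^ i" "m = d * i"
    using homogeneous_eq_power_if_principal[OF u dvd assms(4) False] by blast
  obtain b j where b: "b \<in> G 0" "s = b * u ^ j" "n = d * j"
    using homogeneous_eq_power_if_principal[OF u dvd assms(5,6)] by blast
  have "j \<le> i" using c(3) b(3) assms(7) u(2) by simp
  have "b \<noteq> 0" using b(2) assms(6) by auto
  then obtain b' where b': "b' \<in> G 0" "b * b' = 1" using G_0_inverse b(1) by blast
  have "s * (c * b' * u ^ (i - j)) = (b * b') * (c * (u ^ j * u ^ (i - j)))"
    unfolding b(2) by (simp only: ac_simps)
  also have "\<dots> = r"
    using b'(2) c(2) \<open>j \<le> i\<close> by (simp add: power_add[symmetric])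
  finally have "r = s * (c * b' * u ^ (i - j))" ..
  moreover have "c * b' * u ^ (i - j) \<in> G (m - n)"
  proof (rule G_mult'[OF G_mult[OF c(1) b'(1)] G_power[OF u(1), of "i - j"]])
    show "m - n = 0 + 0 + (i - j) * d" using c(3) b(3) by (simp add: diff_mult_distrib2 mult.commute)
  qed
  ultimately show ?thesis by blast
qed (auto intro: bexI[of _ 0])

text \<open>In that case division with remainder, carried out on leading components, makes every ideal
  principal, so that there are no chains of three primes.\<close>

lemma ideal_principal_if_irrelevant_principal:
  assumes u: "u \<in> G d" "d > 0" and dvd: "\<forall>n>0. \<forall>r\<in>G n. u dvd r"
    and I: "ideal_UNIV (I :: 'a set)"
  obtains f where "f \<in> I" "\<And>r. r \<in> I \<Longrightarrow> f dvd r"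
proof (cases "I \<subseteq> {0}")
  case True
  then show ?thesis using that[of 0] ideal_zero[OF I] by auto
next
  case False
  \<comment> \<open>\<open>f\<close> is a nonzero element of least degree; \<open>below r M\<close> says that \<open>r\<close> has degree less than \<open>M\<close>,
     so that \<open>f\<close> has degree \<open>M - 1\<close> with leading component \<open>top\<close>.\<close>
  define below where "below r M \<longleftrightarrow> (\<forall>n\<ge>M. component n r = 0)" for r M
  define M where "M = (LEAST M. \<exists>r\<in>I. r \<noteq> 0 \<and> below r M)"
  have "\<exists>M. \<exists>r\<in>I. r \<noteq> 0 \<and> below r M"
    using False component_bound unfolding below_def by (metis singletonI subsetI)
  from LeastI_ex[OF this] obtain f where f: "f \<in> I" "f \<noteq> 0" "below f M" unfolding M_def by blast
  have least: "r = 0" if "r \<in> I" "below r N" "N < M" for r N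
    using not_less_Least[of N "\<lambda>M. \<exists>r\<in>I. r \<noteq> 0 \<and> below r M"] that unfolding M_def by blast
  have "M > 0"
  proof (rule ccontr)
    assume "\<not> M > 0"
    then show False using f eq_0_if_comp_0[of f] by (simp add: below_def)
  qed
  define top where "top = component (M - 1) f"
  have "top \<noteq> 0"
  proof
    assume "top = 0"
    have "below f (M - 1)" unfolding below_def
    proof (intro allI impI)
      fix n assume "M - 1 \<le> n"
      then consider "n = M - 1" | "n \<ge> M" using \<open>M > 0\<close> by linarith
      then show "component n f = 0" using f(3) \<open>top = 0\<close> by cases (auto simp: below_def top_def)
    qed
    then show False using least[OF f(1), of "M - 1"] f(2) \<open>M > 0\<close> by simp
  qed
  have "f dvd r" if "r \<in> I" "below r N" for r N
    using that
  proof (induction N arbitrary: r)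
    case 0
    then show ?case using least \<open>M > 0\<close> by auto
  next
    case (Suc N)
    show ?case
    proof (cases "Suc N < M")
      case True
      then show ?thesis using least Suc.prems by auto
    next
      case False
      then have "M - 1 \<le> N" by linarith
      moreover have "top \<in> G (M - 1)" unfolding top_def by (rule component_in)
      ultimately obtain t where t: "t \<in> G (N - (M - 1))" "component N r = top * t"
        using homogeneous_dvd_if_principal[OF u dvd component_in[of N r] _ \<open>top \<noteq> 0\<close>, of "M - 1"]
        by blast
      have "below (r - f * t) N" unfolding below_def
      proof (intro allI impI)
        fix n assume n: "N \<le> n"
        have ft: "component n (f * t) = component (n - (N - (M - 1))) f * t"
          using n component_mult_homogeneous[OF t(1), of n f] by simp
        show "component n (r - f * t) = 0"
        proof (cases "n = N")
          case True
          then have "n - (N - (M - 1)) = M - 1" using False \<open>M > 0\<close> by linarith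
          then show ?thesis using ft t(2) True by (simp add: component_diff top_def)
        next
          case neq: False
          then have "n - (N - (M - 1)) \<ge> M" "Suc N \<le> n" using n False \<open>M > 0\<close> by linarith+
          then show ?thesis using ft f(3) Suc.prems(2) by (simp add: component_diff below_def)
        qed
      qed
      moreover have "r - f * t \<in> I"
        using ideal_diff[OF I Suc.prems(1)] ideal_mult_right[OF I f(1)] by blast
      ultimately have "f dvd r - f * t" using Suc.IH by blast
      then show ?thesis by (metis diff_add_cancel dvd_add dvd_triv_left)
    qed
  qed
  moreover have "\<exists>N. below r N" for r using component_bound unfolding below_def by metis
  ultimately show ?thesis using that f(1) by blast
qed

lemma irrelevant_not_principal:
  assumes dim: "2 \<le> krull_dim (ring_on (UNIV :: 'a set))"
    and u: "u \<in> G d" "d > 0"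
  obtains n r where "r \<in> G n" "n > 0" "\<not> u dvd r"
proof -
  have "\<exists>n r. r \<in> G n \<and> n > 0 \<and> \<not> u dvd r"
  proof (rule ccontr)
    assume neg: "\<not> ?thesis"
    obtain P\<^sub>0 P\<^sub>1 P\<^sub>2 :: "'a set" where P: "P\<^sub>1 \<in> prime_spectrum UNIV" "P\<^sub>2 \<in> prime_spectrum UNIV"
      "P\<^sub>0 \<in> prime_spectrum UNIV" "P\<^sub>0 \<subset> P\<^sub>1" "P\<^sub>1 \<subset> P\<^sub>2" by (rule prime_chain_if_dim_ge_2[OF dim])
    have I: "ideal_UNIV P\<^sub>0" "ideal_UNIV P\<^sub>1" "ideal_UNIV P\<^sub>2" and one: "1 \<notin> P\<^sub>2"
      using P by (auto simp: prime_spectrum_iff)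
    obtain f where f: "f \<in> P\<^sub>1" "\<And>r. r \<in> P\<^sub>1 \<Longrightarrow> f dvd r"
      using ideal_principal_if_irrelevant_principal[OF u _ I(2)] neg by blast
    obtain g where g: "g \<in> P\<^sub>2" "\<And>r. r \<in> P\<^sub>2 \<Longrightarrow> g dvd r"
      using ideal_principal_if_irrelevant_principal[OF u _ I(3)] neg by blast
    have "f \<noteq> 0" using f(2) P(4) ideal_zero[OF I(1)] by fastforce
    obtain v where v: "f = g * v" using g(2)[of f] f(1) P(5) by (auto elim: dvdE)
    then have "g \<in> P\<^sub>1 \<or> v \<in> P\<^sub>1" using P(1) f(1) by (auto simp: prime_spectrum_iff)
    then show False
    proof
      assume "g \<in> P\<^sub>1"
      then have "P\<^sub>2 \<subseteq> P\<^sub>1" using g(2) ideal_mult_right[OF I(2)] by (auto elim!: dvdE)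
      then show False using P(5) by blast
    next
      assume "v \<in> P\<^sub>1"
      then obtain w where "v = f * w" using f(2) by (auto elim: dvdE)
      then have "f * (g * w) = f * 1" using v by (simp add: algebra_simps)
      then have "g * w = 1" using \<open>f \<noteq> 0\<close> by (simp only: mult_cancel_left) simp
      then show False using one ideal_mult_right[OF I(3) g(1), of w] by simp
    qed
  qed
  then show ?thesis using that by blast
qed

end

section \<open>Homogeneous fractions that are regular on Proj\<close>

definition colon :: "'a::idom fract \<Rightarrow> 'a set" where
  "colon h = {r. to_fract r * h \<in> range to_fract}"

lemma ideal_colon: "ideal_UNIV (colon h)"
  unfolding ideal_ring_on_iff[OF subring_closed_UNIV]
proof (intro conjI ballI subset_UNIV)
  have "to_fract 0 * h = to_fract 0" by simp
  then show "0 \<in> colon h" unfolding colon_def mem_Collect_eq by (rule range_eqI)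
next
  fix a b assume "a \<in> colon h" "b \<in> colon h"
  then obtain s t where "to_fract a * h = to_fract s" "to_fract b * h = to_fract t"
    by (auto simp: colon_def)
  then have "to_fract (a + b) * h = to_fract (s + t)" by (simp add: distrib_right)
  then show "a + b \<in> colon h" unfolding colon_def mem_Collect_eq by (rule range_eqI)
next
  fix a b assume "b \<in> colon h"
  then obtain t where "to_fract b * h = to_fract t" by (auto simp: colon_def)
  then have "to_fract (a * b) * h = to_fract (a * t)" by (simp add: mult.assoc)
  then show "a * b \<in> colon h" unfolding colon_def mem_Collect_eq by (rule range_eqI)
qed

lemma one_in_colon: "1 \<in> colon h \<longleftrightarrow> h \<in> range to_fract"
  by (simp add: colon_def)

lemma to_fract_mult_Fract_eq:
  "b \<noteq> 0 \<Longrightarrow> to_fract r * Fract a b = to_fract s \<longleftrightarrow> r * a = s * b"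
  by (simp add: to_fract_def eq_fract)

context graded_domain
begin

text \<open>A homogeneous fraction can be compared with ring elements degree by degree.\<close>

lemma colon_component:
  assumes ab: "a \<in> G k" "b \<in> G m" "b \<noteq> 0" and "r \<in> colon (Fract a b)"
  shows "component n r \<in> colon (Fract a b)"
proof -
  obtain s where s: "r * a = s * b"
    using assms(4) to_fract_mult_Fract_eq[OF ab(3)] by (auto simp: colon_def)
  have "component n r * a = component (n + k) (s * b)"
    using component_mult_homogeneous[OF ab(1), of "n + k" r] s by simp
  then have "component n r * a = (if m \<le> n + k then component (n + k - m) s else 0) * b"
    by (simp add: component_mult_homogeneous[OF ab(2)])
  then show ?thesis
    unfolding colon_def mem_Collect_eq
    using to_fract_mult_Fract_eq[OF ab(3)] by (metis rangeI)
qed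

text \<open>A normal graded domain of dimension at least two has depth at least two at the irrelevant
  ideal. Indeed, let \<open>h\<close> multiply this ideal \<open>M\<close> into the ring. If \<open>h M \<subseteq> M\<close>, then \<open>h\<close> is integral.
  Otherwise some product of \<open>h\<close> with an element of \<open>M\<close> has a nonzero component in degree \<open>0\<close>;
  as \<open>h\<close> is homogeneous, it then is a constant divided by a homogeneous element \<open>u\<close>, and this
  \<open>u\<close> generates \<open>M\<close>, which the dimension excludes.\<close>

lemma in_ring_if_irrelevant_subset_colon:
  assumes noeth: "noetherian_ring (ring_on (UNIV :: 'a set))"
    and normal: "normal_domain TYPE('a)"
    and dim: "2 \<le> krull_dim (ring_on (UNIV :: 'a set))"
    and x: "x \<in> G 1" "x \<noteq> 0"
    and ab: "a \<in> G k" "b \<in> G m" "b \<noteq> 0"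
    and irr: "\<And>r. component 0 r = 0 \<Longrightarrow> r \<in> colon (Fract a b)"
  shows "Fract a b \<in> range to_fract"
proof (cases "\<forall>r s. component 0 r = 0 \<longrightarrow> to_fract r * Fract a b = to_fract s \<longrightarrow> component 0 s = 0")
  case True
  have "\<exists>r. component 0 r = 0 \<and> to_fract x * Fract a b ^ j = to_fract r" for j
  proof (induction j)
    case 0
    show ?case using x by (auto simp: component_homogeneous)
  next
    case (Suc j)
    then obtain r where r: "component 0 r = 0" "to_fract x * Fract a b ^ j = to_fract r" by blast
    then obtain s where s: "to_fract r * Fract a b = to_fract s" using irr by (auto simp: colon_def)
    have "to_fract x * Fract a b ^ Suc j = (to_fract x * Fract a b ^ j) * Fract a b"
      by (simp only: power_Suc ac_simps)
    then have "to_fract x * Fract a b ^ Suc j = to_fract s" using r(2) s by simp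
    then show ?case using True r(1) s by blast
  qed
  then have "to_fract x * Fract a b ^ j \<in> range to_fract" for j by (metis rangeI)
  then have "integral_over_domain (Fract a b)"
    by (rule integral_if_bounded_denominators[OF noeth x(2)])
  then show ?thesis using normal by (simp add: normal_domain_def to_fract_def[abs_def])
next
  case False
  then obtain r s where rs: "component 0 r = 0" "to_fract r * Fract a b = to_fract s"
    "component 0 s \<noteq> 0" by blast
  then have eq: "r * a = s * b" using to_fract_mult_Fract_eq[OF ab(3)] by simp
  \<comment> \<open>Here \<open>Fract a b = c / u\<close>: compare components of degree \<open>m\<close> in \<open>r * a = s * b\<close>.\<close>
  define c where "c = component 0 s"
  define u where "u = component (m - k) r"
  have "component m (r * a) = c * b"
    unfolding eq c_def using component_mult_homogeneous[OF ab(2), of m s] by simp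
  then have cb: "c * b = (if k \<le> m then u * a else 0)"
    by (auto simp: component_mult_homogeneous[OF ab(1)] u_def split: if_splits)
  have "c * b \<noteq> 0" using rs(3) ab(3) by (simp add: c_def)
  then have km: "k \<le> m" and ua: "u * a = c * b" and "u \<noteq> 0" using cb by (auto split: if_splits)
  have "m - k > 0" using \<open>u \<noteq> 0\<close> rs(1) unfolding u_def by (metis gr0I)
  obtain n z where z: "z \<in> G n" "n > 0" "\<not> u dvd z"
    by (rule irrelevant_not_principal[OF dim _ \<open>m - k > 0\<close>, of u]) (auto simp: u_def)
  obtain d where d: "c * d = 1" using G_0_inverse[of c] rs(3) by (auto simp: c_def)
  have "component 0 z = 0" using z by (simp add: component_homogeneous)
  then obtain t where "to_fract z * Fract a b = to_fract t" using irr by (auto simp: colon_def)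
  then have "z * a = t * b" using to_fract_mult_Fract_eq[OF ab(3)] by simp
  note zt = this
  have "b * (c * z) = (c * b) * z" by (simp only: ac_simps)
  also have "\<dots> = u * (z * a)" unfolding ua[symmetric] by (simp only: ac_simps)
  also have "\<dots> = b * (u * t)" unfolding zt by (simp only: ac_simps)
  finally have "c * z = u * t" using ab(3) by simp
  then have "(c * d) * z = u * (t * d)" by (simp add: ac_simps)
  then have "z = u * (t * d)" using d by simp
  then show ?thesis using z(3) by simp
qed

text \<open>If \<open>h\<close> is not in the ring, then among the ideals \<open>colon (c h)\<close> with \<open>c\<close> homogeneous
  and \<open>c h\<close> not in the ring a maximal one is a homogeneous prime. By the local condition it is not a
  point of Proj, so it is the irrelevant ideal.\<close>

lemma in_ring_if_locally_in_ring:
  assumes noeth: "noetherian_ring (ring_on (UNIV :: 'a set))"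
    and normal: "normal_domain TYPE('a)"
    and dim: "2 \<le> krull_dim (ring_on (UNIV :: 'a set))"
    and x: "x \<in> G 1" "x \<noteq> 0"
    and ab: "a \<in> G k" "b \<in> G m" "b \<noteq> 0"
    and loc: "\<And>P. P \<in> Proj_points G \<Longrightarrow> \<exists>r. r \<notin> P \<and> r \<in> colon (Fract a b)"
  shows "Fract a b \<in> range to_fract"
proof (rule ccontr)
  assume notin: "Fract a b \<notin> range to_fract"
  define h where "h = Fract a b"
  define F where "F = {colon (to_fract c * h) |c. c \<in> (\<Union>n. G n) \<and> to_fract c * h \<notin> range to_fract}"
  have "colon (to_fract 1 * h) \<in> F"
    unfolding F_def mem_Collect_eq
    by (intro exI[of _ 1] conjI refl UN_I[of 0]) (use notin in \<open>auto simp: h_def\<close>)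
  then have "F \<noteq> {}" by blast
  moreover have "ideal_UNIV I" if "I \<in> F" for I using that ideal_colon unfolding F_def by blast
  ultimately obtain M where MF: "M \<in> F" and max: "\<And>I. I \<in> F \<Longrightarrow> M \<subseteq> I \<Longrightarrow> I = M"
    using maximal_ideal_in_family[OF noeth, of F] by metis
  then obtain c l where c: "c \<in> G l" "to_fract c * h \<notin> range to_fract" "M = colon (to_fract c * h)"
    unfolding F_def by blast
  have ch: "to_fract c * h = Fract (c * a) b" by (simp add: h_def to_fract_def)
  have ca: "c * a \<in> G (l + k)" using G_mult c(1) ab(1) by blast
  have I: "ideal_UNIV M" unfolding c(3) by (rule ideal_colon)
  have cl: "component n r \<in> M" if "r \<in> M" for r n
    using colon_component[OF ca ab(2,3)] that unfolding c(3) ch by blast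
  have one: "1 \<notin> M" using c(2,3) one_in_colon by blast
  have pr: "r \<in> M \<or> s \<in> M" if rs: "r \<in> G i" "s \<in> G j" "r * s \<in> M" for i j r s
  proof (cases "s \<in> M")
    case False
    have eq: "to_fract (s * c) * h = to_fract s * (to_fract c * h)" by (simp add: mult_ac)
    have "to_fract (s * c) * h \<notin> range to_fract" using False unfolding c(3) colon_def eq by blast
    then have "colon (to_fract (s * c) * h) \<in> F"
      unfolding F_def using G_mult[OF rs(2) c(1)] by blast
    moreover have "M \<subseteq> colon (to_fract (s * c) * h)"
    proof
      fix t assume "t \<in> M"
      then have "s * t \<in> M" by (rule ideal_mult[OF I])
      then show "t \<in> colon (to_fract (s * c) * h)" unfolding c(3) colon_def by (simp add: mult_ac)
    qed
    ultimately have "colon (to_fract (s * c) * h) = M" by (rule max)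
    moreover have "r \<in> colon (to_fract (s * c) * h)"
      using rs(3) unfolding c(3) colon_def by (simp add: mult_ac)
    ultimately show ?thesis by blast
  qed simp
  have prime: "M \<in> prime_spectrum UNIV"
    by (rule prime_if_homogeneously_prime[OF I]) (fact cl one pr)+
  have "M \<notin> Proj_points G"
  proof
    assume "M \<in> Proj_points G"
    then obtain r where r: "r \<notin> M" "r \<in> colon h" using loc unfolding h_def by blast
    then have "c * r \<in> colon h" using ideal_mult[OF ideal_colon] by blast
    then have "r \<in> M" unfolding c(3) colon_def by (simp add: mult_ac)
    then show False using r(1) by simp
  qed
  then have irr: "z \<in> M" if "z \<in> G n" "n > 0" for z n
    using prime cl that unfolding Proj_points_iff by blast
  have "r \<in> colon (Fract (c * a) b)" if "component 0 r = 0" for r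
  proof -
    have "component n r \<in> M" for n using that irr[OF component_in, of n] ideal_zero[OF I] by (cases "n = 0") auto
    then have "(\<Sum>n | component n r \<noteq> 0. component n r) \<in> M" by (intro ideal_sum[OF I])
    then show ?thesis by (simp add: sum_comp_support c(3) ch)
  qed
  then have "Fract (c * a) b \<in> range to_fract"
    by (rule in_ring_if_irrelevant_subset_colon[OF noeth normal dim x ca ab(2,3)])
  then show False using c(2) ch by simp
qed

lemma degree_of_homogeneous_fraction:
  assumes ab: "a \<in> G (m + n)" "b \<in> G m" "b \<noteq> 0" and "Fract a b = to_fract r"
  shows "r \<in> G n"
proof (rule homogeneous_if_comp)
  fix j assume "j \<noteq> n"
  have "a = r * b" using assms(4) ab(3) by (simp add: to_fract_def eq_fract)
  then have "component j r * b = component (j + m) a"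
    using component_mult_homogeneous[OF ab(2), of "j + m" r] by simp
  then have "component j r * b = 0" using component_homogeneous[OF ab(1)] \<open>j \<noteq> n\<close> by simp
  then show "component j r = 0" using ab(3) by simp
qed

end

section \<open>The standard opens of degree one are affine\<close>

definition Spec_sections :: "'k::field set \<Rightarrow> 'k set set \<Rightarrow> ('k set \<Rightarrow> 'k) set" where
  "Spec_sections A U = {s \<in> extensional U. \<forall>p\<in>U. \<exists>V. openin (zariski A) V \<and> p \<in> V \<and> V \<subseteq> U \<and>
     (\<exists>a\<in>A. \<exists>b\<in>A. \<forall>q\<in>V. b \<notin> q \<and> s q = a / b)}"

lemma Spec_sectionsE:
  assumes "s \<in> Spec_sections A U" "p \<in> U"
  obtains V a b where "openin (zariski A) V" "p \<in> V" "V \<subseteq> U" "a \<in> A" "b \<in> A"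
    "\<And>q. q \<in> V \<Longrightarrow> b \<notin> q \<and> s q = a / b"
  using assms(1)[unfolded Spec_sections_def, THEN CollectD, THEN conjunct2, THEN bspec, OF assms(2)]
  by (elim exE conjE bexE) (rule that, assumption+, erule bspec)

lemma top_of_Spec [simp]: "top_of (Spec A) = zariski A"
  by (simp add: Spec_def)

lemma sheaf_of_Spec: "sheaf_of (Spec A) U = function_ring U (Spec_sections A U)"
  by (simp add: Spec_def Spec_sections_def)

lemma topspace_zariski:
  assumes "subring_closed A"
  shows "topspace (zariski A) = prime_spectrum A"
proof
  show "topspace (zariski A) \<subseteq> prime_spectrum A"
    using openin_topspace[of "zariski A"] unfolding openin_zariski by auto
  have "1 \<in> A" using assms by (simp add: subring_closed_def)
  then have "openin (zariski A) (prime_spectrum A)"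
    unfolding openin_zariski using prime_spectrum_iff[OF assms] by (intro exI[of _ "{1}"]) auto
  then show "prime_spectrum A \<subseteq> topspace (zariski A)" by (rule openin_subset)
qed

text \<open>Sections are functions on points, so a map of structure sheaves over a bijection of points is
  given by composing with the inverse bijection. It remains to know that the local
  conditions defining the sections correspond.\<close>

lemma function_ring_iso_reindex:
  assumes gf: "\<And>p. p \<in> U \<Longrightarrow> g (f p) = p"
    and ext: "S \<subseteq> extensional U" "S' \<subseteq> extensional (f ` U)"
    and iff: "\<And>s. s \<in> extensional U \<Longrightarrow> s \<in> S \<longleftrightarrow> (\<lambda>q\<in>f ` U. s (g q)) \<in> S'"
  shows "(\<lambda>s. \<lambda>q\<in>f ` U. s (g q)) \<in> ring_iso (function_ring U S) (function_ring (f ` U) S')"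
proof (rule ring_iso_memI)
  let ?h = "\<lambda>s. \<lambda>q\<in>f ` U. s (g q)" and ?k = "\<lambda>t. \<lambda>p\<in>U. t (f p)"
  have kh: "?k (?h s) = s" if "s \<in> extensional U" for s
    using that gf by (auto simp: fun_eq_iff extensional_def)
  have hk: "?h (?k t) = t" if "t \<in> extensional (f ` U)" for t
    using that gf by (auto simp: fun_eq_iff extensional_def)
  have "bij_betw ?h S S'"
  proof (rule bij_betw_byWitness[of _ ?k])
    show "\<forall>s\<in>S. ?k (?h s) = s" "\<forall>t\<in>S'. ?h (?k t) = t" using kh hk ext by blast+
    show "?h ` S \<subseteq> S'" using iff ext(1) by blast
    show "?k ` S' \<subseteq> S"
    proof (rule image_subsetI)
      fix t assume t: "t \<in> S'"
      then have "?h (?k t) = t" using hk ext(2) by blast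
      then show "?k t \<in> S" using iff[of "?k t"] t by (metis restrict_extensional)
    qed
  qed
  then show "bij_betw ?h (carrier (function_ring U S)) (carrier (function_ring (f ` U) S'))"
    by (simp add: function_ring_def)
  fix s assume "s \<in> carrier (function_ring U S)"
  then have "s \<in> S" by (simp add: function_ring_def)
  then have "?h s \<in> S'" using iff ext(1) by blast
  then show "?h s \<in> carrier (function_ring (f ` U) S')" by (simp add: function_ring_def)
qed (auto simp: function_ring_def fun_eq_iff gf)

context graded_domain
begin

lemma Proj_sectionsE:
  assumes "s \<in> Proj_sections U" "p \<in> U"
  obtains V n a b where "openin (Proj_topology G) V" "p \<in> V" "V \<subseteq> U" "a \<in> G n" "b \<in> G n"
    "\<And>q. q \<in> V \<Longrightarrow> b \<notin> q \<and> s q = Fract a b"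
  using assms(1)[unfolded Proj_sections_def, THEN CollectD, THEN conjunct2, THEN bspec, OF assms(2)]
  by (elim exE conjE bexE) (rule that, assumption+, erule bspec)

definition degree_zero_localization :: "'a \<Rightarrow> 'a fract set" where
  "degree_zero_localization y = {Fract a (y ^ k) |a k. a \<in> G k}"

definition dehomogenize :: "'a \<Rightarrow> 'a set \<Rightarrow> 'a fract set" where
  "dehomogenize y P = {Fract a (y ^ k) |a k. a \<in> G k \<and> a \<in> P}"

text \<open>The inverse of \<open>dehomogenize y\<close>. A general ring element has no value on the open set \<open>y \<noteq> 0\<close>, only
  its components do, after division by the power of \<open>y\<close> of the same degree.\<close>

definition homogenize :: "'a \<Rightarrow> 'a fract set \<Rightarrow> 'a set" where
  "homogenize y Q = {r. \<forall>k. Fract (component k r) (y ^ k) \<in> Q}"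

context
  fixes y :: 'a
  assumes y: "y \<in> G 1" "y \<noteq> 0"
begin

lemma y_power: "y ^ k \<in> G k" "y ^ k \<noteq> 0"
  using y G1_power by auto

lemma add_over_powers: "Fract a (y ^ k) + Fract b (y ^ l) = Fract (a * y ^ l + b * y ^ k) (y ^ (k + l))"
  using y by (simp add: power_add)

lemma mult_over_powers: "Fract a (y ^ k) * Fract b (y ^ l) = Fract (a * b) (y ^ (k + l))"
  by (simp add: power_add)

lemma numerator_add: "a \<in> G k \<Longrightarrow> b \<in> G l \<Longrightarrow> a * y ^ l + b * y ^ k \<in> G (k + l)"
  using G_mult[OF _ y_power(1)] by (metis G_add add.commute)

lemma one_over_powers: "1 = Fract 1 (y ^ 0)"
  by (simp add: One_fract_def)

lemma zero_over_powers: "0 = Fract 0 (y ^ k)"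
  using y by (simp add: Zero_fract_def eq_fract)

lemma subring_closed_degree_zero_localization: "subring_closed (degree_zero_localization y)"
proof -
  let ?A = "degree_zero_localization y"
  have "1 \<in> ?A" unfolding degree_zero_localization_def using one_over_powers G_one by blast
  moreover have "u + v \<in> ?A" "u * v \<in> ?A" if uv: "u \<in> ?A" "v \<in> ?A" for u v
  proof -
    obtain a k b l where *: "u = Fract a (y ^ k)" "a \<in> G k" "v = Fract b (y ^ l)" "b \<in> G l"
      using uv unfolding degree_zero_localization_def by blast
    show "u + v \<in> ?A" unfolding degree_zero_localization_def *(1,3) add_over_powers
      using numerator_add[OF *(2,4)] by blast
    show "u * v \<in> ?A" unfolding degree_zero_localization_def *(1,3) mult_over_powers
      using G_mult[OF *(2,4)] by blast
  qed
  moreover have "- u \<in> ?A" if u: "u \<in> ?A" for u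
  proof -
    obtain a k where *: "u = Fract a (y ^ k)" "a \<in> G k"
      using u unfolding degree_zero_localization_def by blast
    have "- u = Fract (- a) (y ^ k)" unfolding * by simp
    then show ?thesis unfolding degree_zero_localization_def using G_uminus[OF *(2)] by blast
  qed
  ultimately show ?thesis unfolding subring_closed_def by blast
qed

text \<open>Membership can be tested on any representation of the fraction, since a prime that does not
  contain \<open>y\<close> contains \<open>a\<close> as soon as it contains \<open>a y\<^sup>l\<close>.\<close>

lemma Fract_in_dehomogenize:
  assumes P: "P \<in> basic_open y" and a: "a \<in> G k"
  shows "Fract a (y ^ k) \<in> dehomogenize y P \<longleftrightarrow> a \<in> P"
proof
  have P': "P \<in> Proj_points G" "y \<notin> P" using P by (auto simp: basic_open_def)
  assume "Fract a (y ^ k) \<in> dehomogenize y P"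
  then obtain b l where b: "Fract a (y ^ k) = Fract b (y ^ l)" "b \<in> P"
    unfolding dehomogenize_def by blast
  then have "a * y ^ l = b * y ^ k" using y by (simp add: eq_fract)
  then have "a * y ^ l \<in> P" using ideal_mult_right[OF Proj_ideal[OF P'(1)] b(2)] by simp
  then show "a \<in> P" using Proj_prime[OF P'(1)] Proj_power[OF P'(1)] P'(2) by blast
qed (use a in \<open>auto simp: dehomogenize_def\<close>)

lemma dehomogenize_prime:
  assumes P: "P \<in> basic_open y"
  shows "dehomogenize y P \<in> prime_spectrum (degree_zero_localization y)"
proof -
  let ?A = "degree_zero_localization y" and ?Q = "dehomogenize y P"
  have P': "P \<in> Proj_points G" using P by (auto simp: basic_open_def)
  note I = Proj_ideal[OF P']
  have "ideal ?Q (ring_on ?A)"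
    unfolding ideal_ring_on_iff[OF subring_closed_degree_zero_localization]
  proof (intro conjI ballI)
    show "?Q \<subseteq> ?A" by (auto simp: dehomogenize_def degree_zero_localization_def)
    show "0 \<in> ?Q" unfolding dehomogenize_def using zero_over_powers[of 0] ideal_zero[OF I] G_zero by blast
  next
    fix u v assume "u \<in> ?Q" "v \<in> ?Q"
    then obtain a k b l where *: "u = Fract a (y ^ k)" "a \<in> G k" "v = Fract b (y ^ l)" "b \<in> G l"
      and ab: "a \<in> P" "b \<in> P"
      unfolding dehomogenize_def by blast
    show "u + v \<in> ?Q"
      unfolding dehomogenize_def *(1,3) add_over_powers
      using numerator_add[OF *(2,4)] ideal_add[OF I ideal_mult_right[OF I ab(1)] ideal_mult_right[OF I ab(2)]]
      by blast
  next
    fix u v assume "u \<in> ?A" "v \<in> ?Q"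
    then obtain a k b l where *: "u = Fract a (y ^ k)" "a \<in> G k" "v = Fract b (y ^ l)" "b \<in> G l"
      and ab: "b \<in> P"
      unfolding dehomogenize_def degree_zero_localization_def by blast
    show "u * v \<in> ?Q"
      unfolding dehomogenize_def *(1,3) mult_over_powers
      using G_mult[OF *(2,4)] ideal_mult[OF I ab] by blast
  qed
  moreover have "1 \<notin> ?Q"
    using Fract_in_dehomogenize[OF P G_one] Proj_one[OF P'] one_over_powers by simp
  moreover have "u \<in> ?Q \<or> v \<in> ?Q" if uv: "u \<in> ?A" "v \<in> ?A" "u * v \<in> ?Q" for u v
  proof -
    obtain a k b l where *: "u = Fract a (y ^ k)" "a \<in> G k" "v = Fract b (y ^ l)" "b \<in> G l"
      using uv(1,2) unfolding degree_zero_localization_def by blast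
    then have "a * b \<in> P"
      using uv(3) Fract_in_dehomogenize[OF P G_mult[OF *(2,4)]]
      unfolding *(1,3) mult_over_powers by blast
    then show ?thesis using Proj_prime[OF P'] Fract_in_dehomogenize[OF P] * by blast
  qed
  ultimately show ?thesis
    unfolding prime_spectrum_iff[OF subring_closed_degree_zero_localization] by blast
qed

lemma prime_of_localization:
  assumes "Q \<in> prime_spectrum (degree_zero_localization y)"
  shows "0 \<in> Q" "1 \<notin> Q" "u \<in> Q \<Longrightarrow> v \<in> Q \<Longrightarrow> u + v \<in> Q"
    "u \<in> degree_zero_localization y \<Longrightarrow> v \<in> Q \<Longrightarrow> u * v \<in> Q"
    "u \<in> degree_zero_localization y \<Longrightarrow> v \<in> degree_zero_localization y \<Longrightarrow> u * v \<in> Q \<Longrightarrow> u \<in> Q \<or> v \<in> Q"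
    "Q \<subseteq> degree_zero_localization y"
  using assms by (auto simp: prime_spectrum_iff[OF subring_closed_degree_zero_localization]
      ideal_ring_on_iff[OF subring_closed_degree_zero_localization])

lemma Fract_in_localization: "a \<in> G k \<Longrightarrow> Fract a (y ^ k) \<in> degree_zero_localization y"
  unfolding degree_zero_localization_def by blast

lemma homogeneous_in_homogenize:
  assumes Q: "Q \<in> prime_spectrum (degree_zero_localization y)" and a: "a \<in> G k"
  shows "a \<in> homogenize y Q \<longleftrightarrow> Fract a (y ^ k) \<in> Q"
proof
  assume "a \<in> homogenize y Q"
  then have "Fract (component k a) (y ^ k) \<in> Q" unfolding homogenize_def by blast
  then show "Fract a (y ^ k) \<in> Q" using component_homogeneous[OF a] by simp
next
  assume "Fract a (y ^ k) \<in> Q"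
  then have "Fract (component n a) (y ^ n) \<in> Q" for n
    using component_homogeneous[OF a, of n] prime_of_localization(1)[OF Q] zero_over_powers[of n]
    by (cases "n = k") auto
  then show "a \<in> homogenize y Q" unfolding homogenize_def by blast
qed

lemma homogenize_in_basic_open:
  assumes Q: "Q \<in> prime_spectrum (degree_zero_localization y)"
  shows "homogenize y Q \<in> basic_open y"
proof -
  note Qs = prime_of_localization[OF Q]
  let ?P = "homogenize y Q"
  have Fsum: "Fract (sum f N) (y ^ n) \<in> Q" if "\<And>i. i \<in> N \<Longrightarrow> Fract (f i) (y ^ n) \<in> Q" for f n and N :: "nat set"
    using that
  proof (induction N rule: infinite_finite_induct)
    case (insert i N)
    then have "Fract (f i) (y ^ n) + Fract (sum f N) (y ^ n) \<in> Q" using Qs(3) by blast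
    moreover have "Fract (f i) (y ^ n) + Fract (sum f N) (y ^ n) = Fract (f i + sum f N) (y ^ n)"
      using y by (simp add: eq_fract algebra_simps)
    ultimately show ?case using insert by simp
  qed (use Qs(1) zero_over_powers[of n] in auto)
  have "ideal_UNIV ?P"
    unfolding ideal_ring_on_iff[OF subring_closed_UNIV]
  proof (intro conjI ballI subset_UNIV)
    show "0 \<in> ?P" using Qs(1) zero_over_powers by (simp add: homogenize_def)
  next
    fix a b assume ab: "a \<in> ?P" "b \<in> ?P"
    have "Fract (component k (a + b)) (y ^ k) \<in> Q" for k
    proof -
      have "Fract (component k a) (y ^ k) + Fract (component k b) (y ^ k) \<in> Q"
        using ab Qs(3) by (simp add: homogenize_def)
      moreover have "Fract (component k a) (y ^ k) + Fract (component k b) (y ^ k) = Fract (component k (a + b)) (y ^ k)"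
        using y by (simp add: eq_fract algebra_simps component_add)
      ultimately show ?thesis by simp
    qed
    then show "a + b \<in> ?P" by (simp add: homogenize_def)
  next
    fix a b assume b: "b \<in> ?P"
    have "Fract (component n (a * b)) (y ^ n) \<in> Q" for n
      unfolding component_mult
    proof (rule Fsum)
      fix i assume i: "i \<in> {..n}"
      have "Fract (component i a) (y ^ i) * Fract (component (n - i) b) (y ^ (n - i)) \<in> Q"
        using b Qs(4)[OF Fract_in_localization[OF component_in]] unfolding homogenize_def by blast
      then show "Fract (component i a * component (n - i) b) (y ^ n) \<in> Q"
        using i unfolding mult_over_powers by (simp del: power_Suc)
    qed
    then show "a * b \<in> ?P" by (simp add: homogenize_def)
  qed
  moreover have cl: "component n r \<in> ?P" if "r \<in> ?P" for r n
    using that homogeneous_in_homogenize[OF Q component_in] by (simp add: homogenize_def)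
  moreover have "1 \<notin> ?P"
    using homogeneous_in_homogenize[OF Q G_one] Qs(2) one_over_powers by simp
  moreover have "a \<in> ?P \<or> b \<in> ?P" if ab: "a \<in> G m" "b \<in> G n" "a * b \<in> ?P" for m n a b
  proof -
    have "Fract a (y ^ m) * Fract b (y ^ n) \<in> Q"
      unfolding mult_over_powers using ab homogeneous_in_homogenize[OF Q G_mult] by blast
    then show ?thesis
      using Qs(5)[OF Fract_in_localization[OF ab(1)] Fract_in_localization[OF ab(2)]]
        homogeneous_in_homogenize[OF Q] ab by blast
  qed
  ultimately have "?P \<in> prime_spectrum UNIV" by (rule prime_if_homogeneously_prime)
  moreover have "y \<notin> ?P"
  proof -
    have "Fract y (y ^ 1) = 1" using y by (simp add: One_fract_def eq_fract)
    then show ?thesis using homogeneous_in_homogenize[OF Q y(1)] Qs(2) by metis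
  qed
  ultimately show ?thesis
    using cl y(1) unfolding basic_open_def Proj_points_iff by (auto intro!: exI[of _ 1])
qed

lemma homogenize_dehomogenize:
  assumes P: "P \<in> basic_open y"
  shows "homogenize y (dehomogenize y P) = P"
proof -
  have P': "P \<in> Proj_points G" using P by (auto simp: basic_open_def)
  have "r \<in> P \<longleftrightarrow> (\<forall>k. component k r \<in> P)" for r
    using Proj_comp[OF P'] ideal_sum[OF Proj_ideal[OF P'], of "{n. component n r \<noteq> 0}" "\<lambda>n. component n r"]
    by (auto simp: sum_comp_support)
  then show ?thesis unfolding homogenize_def Fract_in_dehomogenize[OF P component_in] by blast
qed

lemma dehomogenize_homogenize:
  assumes Q: "Q \<in> prime_spectrum (degree_zero_localization y)"
  shows "dehomogenize y (homogenize y Q) = Q"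
proof (intro equalityI subsetI)
  fix u assume "u \<in> dehomogenize y (homogenize y Q)"
  then show "u \<in> Q" using homogeneous_in_homogenize[OF Q] unfolding dehomogenize_def by blast
next
  fix u assume u: "u \<in> Q"
  then obtain a k where "u = Fract a (y ^ k)" "a \<in> G k"
    using prime_of_localization(6)[OF Q] unfolding degree_zero_localization_def by blast
  then show "u \<in> dehomogenize y (homogenize y Q)"
    using u homogeneous_in_homogenize[OF Q] unfolding dehomogenize_def by blast
qed

lemma dehomogenize_image: "dehomogenize y ` basic_open y = prime_spectrum (degree_zero_localization y)"
  using dehomogenize_prime homogenize_in_basic_open dehomogenize_homogenize by force

lemma openin_dehomogenize_image:
  assumes "openin (Proj_topology G) U" "U \<subseteq> basic_open y"
  shows "openin (zariski (degree_zero_localization y)) (dehomogenize y ` U)"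
proof -
  obtain E where E: "U = {P \<in> Proj_points G. \<not> E \<subseteq> P}" using assms(1) by (auto simp: openin_Proj)
  define E' where "E' = {Fract (component k e) (y ^ k) |k e. e \<in> E}"
  have "E' \<subseteq> degree_zero_localization y" using Fract_in_localization[OF component_in] by (auto simp: E'_def)
  moreover have mem: "P \<in> U \<longleftrightarrow> \<not> E' \<subseteq> dehomogenize y P" if P: "P \<in> basic_open y" for P
  proof -
    have P': "P \<in> Proj_points G" using P by (auto simp: basic_open_def)
    have "E' \<subseteq> dehomogenize y P \<longleftrightarrow> (\<forall>e\<in>E. \<forall>k. Fract (component k e) (y ^ k) \<in> dehomogenize y P)"
      unfolding E'_def by blast
    also have "\<dots> \<longleftrightarrow> E \<subseteq> homogenize y (dehomogenize y P)" unfolding homogenize_def by blast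
    also have "\<dots> \<longleftrightarrow> E \<subseteq> P" by (simp add: homogenize_dehomogenize[OF P])
    finally show ?thesis using E P' by blast
  qed
  moreover have "dehomogenize y ` U = {Q \<in> prime_spectrum (degree_zero_localization y). \<not> E' \<subseteq> Q}"
  proof (intro equalityI subsetI)
    fix Q assume "Q \<in> dehomogenize y ` U"
    then show "Q \<in> {Q \<in> prime_spectrum (degree_zero_localization y). \<not> E' \<subseteq> Q}"
      using mem assms(2) dehomogenize_prime by blast
  next
    fix Q assume "Q \<in> {Q \<in> prime_spectrum (degree_zero_localization y). \<not> E' \<subseteq> Q}"
    then obtain P where "P \<in> basic_open y" "Q = dehomogenize y P" "\<not> E' \<subseteq> Q"
      using dehomogenize_image by blast
    then show "Q \<in> dehomogenize y ` U" using mem by blast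
  qed
  ultimately show ?thesis unfolding openin_zariski by blast
qed

lemma openin_dehomogenize_vimage:
  assumes "openin (zariski (degree_zero_localization y)) W"
  shows "openin (Proj_topology G) {P \<in> basic_open y. dehomogenize y P \<in> W}"
proof -
  obtain E' where E': "E' \<subseteq> degree_zero_localization y"
    "W = {Q \<in> prime_spectrum (degree_zero_localization y). \<not> E' \<subseteq> Q}"
    using assms by (auto simp: openin_zariski)
  define E where "E = {a. \<exists>k. a \<in> G k \<and> Fract a (y ^ k) \<in> E'}"
  have "E \<subseteq> P \<longleftrightarrow> E' \<subseteq> dehomogenize y P" if P: "P \<in> basic_open y" for P
  proof
    assume EP: "E \<subseteq> P"
    show "E' \<subseteq> dehomogenize y P"
    proof
      fix u assume "u \<in> E'"
      moreover obtain a k where "u = Fract a (y ^ k)" "a \<in> G k"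
        using \<open>u \<in> E'\<close> E'(1) unfolding degree_zero_localization_def by blast
      ultimately show "u \<in> dehomogenize y P" using EP unfolding E_def dehomogenize_def by blast
    qed
  next
    assume "E' \<subseteq> dehomogenize y P"
    then show "E \<subseteq> P" using Fract_in_dehomogenize[OF P] unfolding E_def by blast
  qed
  then have "{P \<in> basic_open y. dehomogenize y P \<in> W} = basic_open y \<inter> {P \<in> Proj_points G. \<not> E \<subseteq> P}"
    using dehomogenize_prime unfolding E'(2) by (auto simp: basic_open_def)
  moreover have "openin (Proj_topology G) {P \<in> Proj_points G. \<not> E \<subseteq> P}"
    unfolding openin_Proj by blast
  ultimately show ?thesis by (simp add: openin_Int)
qed

text \<open>Open sets correspond because a homogeneous prime contains a set \<open>E\<close> iff it contains all
  components of elements of \<open>E\<close>, and these can be divided by powers of \<open>y\<close>.\<close>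

lemma homeomorphic_map_dehomogenize:
  "homeomorphic_map (subtopology (Proj_topology G) (basic_open y)) (zariski (degree_zero_localization y)) (dehomogenize y)"
proof -
  let ?A = "degree_zero_localization y"
  have sub: "basic_open y \<subseteq> Proj_points G" by (auto simp: basic_open_def)
  have top: "topspace (subtopology (Proj_topology G) (basic_open y)) = basic_open y"
    using sub by (auto simp: topspace_subtopology)
  have "inj_on (dehomogenize y) (basic_open y)"
    by (rule inj_on_inverseI[of _ "homogenize y"]) (rule homogenize_dehomogenize)
  moreover have "openin (subtopology (Proj_topology G) (basic_open y)) {P \<in> basic_open y. dehomogenize y P \<in> W}
      \<longleftrightarrow> openin (zariski ?A) W" if W: "W \<subseteq> prime_spectrum ?A" for W
  proof
    assume "openin (subtopology (Proj_topology G) (basic_open y)) {P \<in> basic_open y. dehomogenize y P \<in> W}"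
    then have "openin (zariski ?A) (dehomogenize y ` {P \<in> basic_open y. dehomogenize y P \<in> W})"
      using openin_dehomogenize_image by (simp add: openin_open_subtopology)
    moreover have "dehomogenize y ` {P \<in> basic_open y. dehomogenize y P \<in> W} = W"
      using W unfolding dehomogenize_image[symmetric] by blast
    ultimately show "openin (zariski ?A) W" by simp
  next
    assume "openin (zariski ?A) W"
    then show "openin (subtopology (Proj_topology G) (basic_open y)) {P \<in> basic_open y. dehomogenize y P \<in> W}"
      using openin_dehomogenize_vimage by (auto simp: openin_open_subtopology)
  qed
  ultimately show ?thesis
    unfolding homeomorphic_map_def quotient_map_def top
      topspace_zariski[OF subring_closed_degree_zero_localization]
    using dehomogenize_image by blast
qed

text \<open>As \<open>y\<close> has degree one, a quotient \<open>a / b\<close> of elements of degree \<open>n\<close> is the quotient of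
  \<open>a / y\<^sup>n\<close> and \<open>b / y\<^sup>n\<close>; this matches the local fractions on the two sides.\<close>

lemma Proj_sections_iff_Spec_sections:
  assumes U: "openin (Proj_topology G) U" "U \<subseteq> basic_open y" and s: "s \<in> extensional U"
  shows "s \<in> Proj_sections U \<longleftrightarrow>
    (\<lambda>q\<in>dehomogenize y ` U. s (homogenize y q)) \<in> Spec_sections (degree_zero_localization y) (dehomogenize y ` U)"
    (is "_ \<longleftrightarrow> ?t \<in> Spec_sections ?A _")
proof
  let ?f = "dehomogenize y" and ?g = "homogenize y"
  have gf: "?g (?f p) = p" if "p \<in> U" for p using that U(2) homogenize_dehomogenize by blast
  have t: "?t (?f p) = s p" if "p \<in> U" for p using that gf by simp
  {
    assume sec: "s \<in> Proj_sections U"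
    have "\<exists>V. openin (zariski ?A) V \<and> q \<in> V \<and> V \<subseteq> ?f ` U \<and>
       (\<exists>a\<in>?A. \<exists>b\<in>?A. \<forall>q\<in>V. b \<notin> q \<and> ?t q = a / b)" if q: "q \<in> ?f ` U" for q
    proof -
      obtain p where p: "p \<in> U" "q = ?f p" using q by blast
      then obtain V n a b where V: "openin (Proj_topology G) V" "p \<in> V" "V \<subseteq> U"
        and ab: "a \<in> G n" "b \<in> G n" "\<And>q. q \<in> V \<Longrightarrow> b \<notin> q \<and> s q = Fract a b"
        using Proj_sectionsE[OF sec p(1)] by metis
      have "Fract b (y ^ n) \<notin> ?f r \<and> ?t (?f r) = Fract a (y ^ n) / Fract b (y ^ n)" if r: "r \<in> V" for r
      proof -
        have rD: "r \<in> basic_open y" "r \<in> U" using r V(3) U(2) by blast+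
        then have "b \<noteq> 0" using ab(3)[OF r] Proj_zero by (auto simp: basic_open_def)
        then have "Fract a (y ^ n) / Fract b (y ^ n) = Fract a b"
          using y by (simp add: eq_fract mult_ac)
        then show ?thesis
          using ab(3)[OF r] Fract_in_dehomogenize[OF rD(1) ab(2)] t[OF rD(2)] by simp
      qed
      then have "\<forall>q\<in>?f ` V. Fract b (y ^ n) \<notin> q \<and> ?t q = Fract a (y ^ n) / Fract b (y ^ n)" by blast
      moreover have "openin (zariski ?A) (?f ` V)"
        using openin_dehomogenize_image V U(2) by blast
      ultimately show ?thesis
        using Fract_in_localization[OF ab(1)] Fract_in_localization[OF ab(2)] V(2,3) p(2)
        by (intro exI[of _ "?f ` V"]) blast
    qed
    then show "?t \<in> Spec_sections ?A (?f ` U)" unfolding Spec_sections_def by simp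
  }
  {
    assume sec: "?t \<in> Spec_sections ?A (?f ` U)"
    have "\<exists>V. openin (Proj_topology G) V \<and> p \<in> V \<and> V \<subseteq> U \<and>
      (\<exists>n. \<exists>a\<in>G n. \<exists>b\<in>G n. \<forall>q\<in>V. b \<notin> q \<and> s q = Fract a b)" if p: "p \<in> U" for p
    proof -
      have "?f p \<in> ?f ` U" using p by blast
      then obtain W u v where W: "openin (zariski ?A) W" "?f p \<in> W" "W \<subseteq> ?f ` U"
        and uv: "u \<in> ?A" "v \<in> ?A" "\<And>q. q \<in> W \<Longrightarrow> v \<notin> q \<and> ?t q = u / v"
        using Spec_sectionsE[OF sec \<open>?f p \<in> ?f ` U\<close>] by metis
      obtain a k b l where ab: "u = Fract a (y ^ k)" "a \<in> G k" "v = Fract b (y ^ l)" "b \<in> G l"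
        using uv(1,2) unfolding degree_zero_localization_def by blast
      define V where "V = {P \<in> basic_open y. ?f P \<in> W}"
      have "V \<subseteq> U"
      proof
        fix P assume P: "P \<in> V"
        then obtain P' where "P' \<in> U" "?f P = ?f P'" using W(3) unfolding V_def by blast
        then have "P = P'" using homogenize_dehomogenize P U(2) unfolding V_def by (metis (no_types, lifting) mem_Collect_eq subsetD)
        then show "P \<in> U" using \<open>P' \<in> U\<close> by simp
      qed
      moreover have "openin (Proj_topology G) V" unfolding V_def by (rule openin_dehomogenize_vimage[OF W(1)])
      moreover have "p \<in> V" using p U(2) W(2) unfolding V_def by blast
      moreover have "b * y ^ k \<notin> r \<and> s r = Fract (a * y ^ l) (b * y ^ k)" if r: "r \<in> V" for r
      proof -
        have rD: "r \<in> basic_open y" "?f r \<in> W" "r \<in> U" using r \<open>V \<subseteq> U\<close> unfolding V_def by blast+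
        then have r': "r \<in> Proj_points G" "y \<notin> r" by (auto simp: basic_open_def)
        have "b \<notin> r" using uv(3)[OF rD(2)] Fract_in_dehomogenize[OF rD(1) ab(4)] ab(3) by blast
        then have "b * y ^ k \<notin> r" using Proj_mult_notin[OF r'(1)] Proj_power[OF r'(1)] r'(2) by blast
        moreover have "s r = u / v" using uv(3)[OF rD(2)] t[OF rD(3)] by simp
        moreover have "u / v = Fract (a * y ^ l) (b * y ^ k)"
          unfolding ab by (simp add: mult_ac)
        ultimately show ?thesis by simp
      qed
      moreover have "a * y ^ l \<in> G (k + l)" using G_mult[OF ab(2) y_power(1)] .
      moreover have "b * y ^ k \<in> G (k + l)" using G_mult[OF ab(4) y_power(1), of k] by (simp add: add.commute)
      ultimately show ?thesis by (intro exI[of _ V]) blast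
    qed
    then show "s \<in> Proj_sections U" unfolding Proj_sections_def by (intro CollectI conjI s ballI)
  }
qed

lemma affine_open_basic_open: "affine_open (Proj G) (basic_open y)"
proof -
  let ?A = "degree_zero_localization y" and ?f = "dehomogenize y" and ?g = "homogenize y"
  let ?h = "\<lambda>U s. \<lambda>q\<in>?f ` U. s (?g q)"
  let ?Z = "open_subspace (Proj G) (basic_open y)"
  have open_iff: "openin (top_of ?Z) U \<longleftrightarrow> openin (Proj_topology G) U \<and> U \<subseteq> basic_open y" for U
    by (simp add: open_subspace_def openin_open_subtopology)
  have gf: "?g (?f p) = p" if "openin (top_of ?Z) U" "p \<in> U" for p U
    using that homogenize_dehomogenize unfolding open_iff by blast
  have "?h U \<in> ring_iso (sheaf_of ?Z U) (sheaf_of (Spec ?A) (?f ` U))" if U: "openin (top_of ?Z) U" for U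
  proof -
    have "?h U \<in> ring_iso (function_ring U (Proj_sections U))
        (function_ring (?f ` U) (Spec_sections ?A (?f ` U)))"
    proof (rule function_ring_iso_reindex)
      show "Proj_sections U \<subseteq> extensional U" "Spec_sections ?A (?f ` U) \<subseteq> extensional (?f ` U)"
        by (auto simp: Proj_sections_def Spec_sections_def)
    qed (use gf[OF U] U Proj_sections_iff_Spec_sections in \<open>auto simp: open_iff\<close>)
    then show ?thesis by (simp add: open_subspace_def sheaf_of_Proj sheaf_of_Spec)
  qed
  moreover have "?h V (restrict s V) = restrict (?h U s) (?f ` V)"
    if "openin (top_of ?Z) U" "openin (top_of ?Z) V" "V \<subseteq> U" for U V and s :: "'a set \<Rightarrow> 'a fract"
    using gf[OF that(2)] that(3) by (fastforce simp: fun_eq_iff)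
  moreover have "homeomorphic_map (top_of ?Z) (top_of (Spec ?A)) ?f"
    using homeomorphic_map_dehomogenize by (simp add: open_subspace_def)
  ultimately have "ringed_space_isomorphic ?Z (Spec ?A)"
    unfolding ringed_space_isomorphic_def
    by (intro exI[of _ ?f] exI[of _ ?h]) blast
  then show ?thesis
    unfolding affine_open_def
    using subring_if_subring_closed[OF subring_closed_degree_zero_localization] by auto
qed

end

end

section \<open>The hyperplane divisor and its section ring\<close>

lemma Fract_power: "b \<noteq> 0 \<Longrightarrow> Fract a b ^ n = Fract (a ^ n) (b ^ n)"
  by (induction n) (auto simp: One_fract_def)

lemma Fract_conv_to_fract: "b \<noteq> 0 \<Longrightarrow> Fract a b = to_fract a / to_fract b"
  by (simp add: to_fract_def)

locale section_ring_setting = graded_domain G for G :: "nat \<Rightarrow> 'a::idom set" +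
  fixes x :: 'a
  assumes x: "x \<in> G 1" "x \<noteq> 0"
    and noeth: "noetherian_ring (ring_on (UNIV :: 'a set))"
    and normal: "normal_domain TYPE('a)"
    and dim: "2 \<le> krull_dim (ring_on (UNIV :: 'a set))"
    and fin: "module_finite_over (degree_one_subalgebra G)"
begin

lemma generic: "{0} \<in> Proj_points G"
  using zero_in_Proj_points[OF x(1) _ x(2)] by simp

text \<open>The divisor of zeros of \<open>x\<close>, viewed as a section of the Serre twist, for which \<open>y\<close> is a generator
  over \<open>basic_open y\<close>. All nonzero \<open>y\<close> of degree one are used, so that no finite cover has to
  be chosen.\<close>

definition hyperplane_divisor :: "('a set set \<times> ('a set \<Rightarrow> 'a fract)) set" where
  "hyperplane_divisor = {(basic_open y, \<lambda>p\<in>basic_open y. Fract x y) |y. y \<in> G 1 \<and> y \<noteq> 0}"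

abbreviation "mult_divisor n \<equiv> cartier_multiple n hyperplane_divisor"

lemma x_power: "x ^ n \<in> G n" "x ^ n \<noteq> 0"
  using x G1_power by auto

lemma mult_divisor_eq:
  "mult_divisor n = {(basic_open y, \<lambda>p\<in>basic_open y. Fract (x ^ n) (y ^ n)) |y. y \<in> G 1 \<and> y \<noteq> 0}"
proof -
  have eq: "(\<lambda>p\<in>basic_open y. (\<lambda>p\<in>basic_open y. Fract x y) p ^ n) = (\<lambda>p\<in>basic_open y. Fract (x ^ n) (y ^ n))"
    if "y \<noteq> 0" for y
    by (rule restrict_ext) (simp add: Fract_power[OF that])
  show ?thesis
    unfolding cartier_multiple_def hyperplane_divisor_def
  proof (intro equalityI subsetI)
    fix z assume "z \<in> {(U, \<lambda>p\<in>U. f p ^ n) |U f. (U, f) \<in> {(basic_open y, \<lambda>p\<in>basic_open y. Fract x y) |y. y \<in> G 1 \<and> y \<noteq> 0}}"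
    then obtain y where "y \<in> G 1" "y \<noteq> 0" "z = (basic_open y, \<lambda>p\<in>basic_open y. (\<lambda>p\<in>basic_open y. Fract x y) p ^ n)"
      by blast
    then show "z \<in> {(basic_open y, \<lambda>p\<in>basic_open y. Fract (x ^ n) (y ^ n)) |y. y \<in> G 1 \<and> y \<noteq> 0}"
      unfolding eq[OF \<open>y \<noteq> 0\<close>] by blast
  next
    fix z assume "z \<in> {(basic_open y, \<lambda>p\<in>basic_open y. Fract (x ^ n) (y ^ n)) |y. y \<in> G 1 \<and> y \<noteq> 0}"
    then obtain y where y: "y \<in> G 1" "y \<noteq> 0" "z = (basic_open y, \<lambda>p\<in>basic_open y. Fract (x ^ n) (y ^ n))" by blast
    show "z \<in> {(U, \<lambda>p\<in>U. f p ^ n) |U f. (U, f) \<in> {(basic_open y, \<lambda>p\<in>basic_open y. Fract x y) |y. y \<in> G 1 \<and> y \<noteq> 0}}"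
      unfolding y(3) eq[OF y(2), symmetric] using y(1,2) by blast
  qed
qed

subsection \<open>Rational sections\<close>

lemma constant_rational_section:
  assumes "openin (Proj_topology G) U" "c \<in> function_field (Proj G)"
  shows "(\<lambda>p\<in>U. c) \<in> rational_sections (Proj G) U"
  unfolding rational_sections_def mem_Collect_eq
proof (intro conjI ballI)
  fix p assume "p \<in> U"
  then show "\<exists>V. openin (top_of (Proj G)) V \<and> p \<in> V \<and> V \<subseteq> U \<and>
      (\<exists>g\<in>function_field (Proj G). \<forall>q\<in>V. (\<lambda>p\<in>U. c) q = g)"
    using assms by (intro exI[of _ U]) auto
qed simp

text \<open>Proj is irreducible: every nonempty open set contains the generic point, so a locally
  constant function is constant.\<close>

lemma rational_section_constant:
  assumes s: "s \<in> rational_sections (Proj G) (Proj_points G)"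
  obtains g where "g \<in> function_field (Proj G)" "s = (\<lambda>p\<in>Proj_points G. g)"
proof -
  have loc: "\<exists>V. openin (Proj_topology G) V \<and> p \<in> V \<and> (\<exists>g\<in>function_field (Proj G). \<forall>q\<in>V. s q = g)"
    if "p \<in> Proj_points G" for p
    using s[unfolded rational_sections_def, THEN CollectD, THEN conjunct2, THEN bspec, OF that] by auto
  have const: "s p = s {0} \<and> s {0} \<in> function_field (Proj G)" if p: "p \<in> Proj_points G" for p
  proof -
    obtain V g where "openin (Proj_topology G) V" "p \<in> V" "g \<in> function_field (Proj G)" "\<forall>q\<in>V. s q = g"
      using loc[OF p] by blast
    then show ?thesis using generic_in_open[OF _ generic] by metis
  qed
  have ext: "s \<in> extensional (Proj_points G)" using s by (simp add: rational_sections_def)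
  have "s = (\<lambda>p\<in>Proj_points G. s {0})"
    by (rule extensionalityI[OF ext]) (use const in auto)
  then show ?thesis using that const[OF generic] by blast
qed

lemma divisor_sections_iff:
  "s \<in> divisor_sections (Proj G) (mult_divisor n) V \<longleftrightarrow> s \<in> rational_sections (Proj G) V \<and>
    (\<forall>y\<in>G 1. y \<noteq> 0 \<longrightarrow> (\<lambda>p\<in>basic_open y \<inter> V. s p * Fract (x ^ n) (y ^ n)) \<in> Proj_sections (basic_open y \<inter> V))"
proof -
  have "(\<lambda>p\<in>basic_open y \<inter> V. s p * (\<lambda>p\<in>basic_open y. Fract (x ^ n) (y ^ n)) p) =
      (\<lambda>p\<in>basic_open y \<inter> V. s p * Fract (x ^ n) (y ^ n))" for y
    by (rule restrict_ext) auto
  moreover have "(\<forall>(U, f)\<in>{(B y, F y) |y. Q y}. R U f) \<longleftrightarrow> (\<forall>y. Q y \<longrightarrow> R (B y) (F y))"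
    for B :: "'a \<Rightarrow> 'a set set" and F :: "'a \<Rightarrow> 'a set \<Rightarrow> 'a fract" and Q R
    by blast
  ultimately show ?thesis
    unfolding divisor_sections_def mult_divisor_eq carrier_sheaf_of_Proj mem_Collect_eq by auto
qed

lemma global_section_fraction:
  assumes "r \<in> G n"
  shows "(\<lambda>p\<in>Proj_points G. Fract r (x ^ n)) \<in> global_sections (Proj G) (mult_divisor n)"
proof -
  have "openin (Proj_topology G) (Proj_points G)" using openin_topspace[of "Proj_topology G"] by simp
  then have "(\<lambda>p\<in>Proj_points G. Fract r (x ^ n)) \<in> rational_sections (Proj G) (Proj_points G)"
    by (rule constant_rational_section) (rule function_field_ProjI[OF generic assms x_power])
  moreover have "(\<lambda>p\<in>basic_open y \<inter> Proj_points G. (\<lambda>p\<in>Proj_points G. Fract r (x ^ n)) p * Fract (x ^ n) (y ^ n))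
      \<in> Proj_sections (basic_open y \<inter> Proj_points G)" if y: "y \<in> G 1" "y \<noteq> 0" for y
  proof (rule global_fraction_in_Proj_sections[OF _ assms G1_power[OF y(1), of n]])
    have int: "basic_open y \<inter> Proj_points G = basic_open y" by (auto simp: basic_open_def)
    show "openin (Proj_topology G) (basic_open y \<inter> Proj_points G)" unfolding int by simp
    fix q assume q: "q \<in> basic_open y \<inter> Proj_points G"
    then show "y ^ n \<notin> q" using Proj_power by (auto simp: basic_open_def)
    have "Fract r (x ^ n) * Fract (x ^ n) (y ^ n) = Fract r (y ^ n)"
      using x y by (simp add: eq_fract)
    then show "(\<lambda>p\<in>basic_open y \<inter> Proj_points G. (\<lambda>p\<in>Proj_points G. Fract r (x ^ n)) p * Fract (x ^ n) (y ^ n)) q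
      = Fract r (y ^ n)" using q by simp
  qed simp
  ultimately show ?thesis by (simp add: divisor_sections_iff)
qed

text \<open>Regularity of \<open>g x\<^sup>n / y\<^sup>n\<close> where \<open>y \<noteq> 0\<close> gives, near each point, a denominator of \<open>g x\<^sup>n\<close> that does
  not vanish there; so \<open>g x\<^sup>n\<close> is in the ring.\<close>

lemma global_section_is_fraction:
  assumes s: "s \<in> global_sections (Proj G) (mult_divisor n)"
  obtains r where "r \<in> G n" "s = (\<lambda>p\<in>Proj_points G. Fract r (x ^ n))"
proof -
  have s': "s \<in> rational_sections (Proj G) (Proj_points G)"
    "\<And>y. y \<in> G 1 \<Longrightarrow> y \<noteq> 0 \<Longrightarrow> (\<lambda>p\<in>basic_open y \<inter> Proj_points G. s p * Fract (x ^ n) (y ^ n))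
      \<in> Proj_sections (basic_open y \<inter> Proj_points G)"
    using s by (simp_all add: divisor_sections_iff)
  obtain g where g: "g \<in> function_field (Proj G)" "s = (\<lambda>p\<in>Proj_points G. g)"
    using rational_section_constant[OF s'(1)] by blast
  obtain m a b where ab: "a \<in> G m" "b \<in> G m" "b \<noteq> 0" "g = Fract a b"
    by (rule function_field_ProjE[OF g(1)])
  have h: "Fract (a * x ^ n) b = g * to_fract (x ^ n)" unfolding ab(4) by (simp add: to_fract_def)
  have deg: "a * x ^ n \<in> G (m + n)" using G_mult[OF ab(1) x_power(1)] .
  have "\<exists>r. r \<notin> P \<and> r \<in> colon (Fract (a * x ^ n) b)" if P: "P \<in> Proj_points G" for P
  proof -
    obtain y where y: "y \<in> G 1" "y \<notin> P" using degree_one_notin_Proj_point[OF fin P] by blast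
    then have "y \<noteq> 0" using Proj_zero[OF P] by blast
    have PU: "P \<in> basic_open y \<inter> Proj_points G" using P y(2) by (simp add: basic_open_def)
    obtain l c d where cd: "d \<notin> P" and val: "(\<lambda>p\<in>basic_open y \<inter> Proj_points G. s p * Fract (x ^ n) (y ^ n)) P = Fract c d"
      using Proj_sections_value[OF s'(2)[OF y(1) \<open>y \<noteq> 0\<close>] PU] by metis
    have "d \<noteq> 0" using cd Proj_zero[OF P] by blast
    have "g * Fract (x ^ n) (y ^ n) = Fract c d" using val PU P g(2) by simp
    then have "g * to_fract (x ^ n) / to_fract (y ^ n) = to_fract c / to_fract d"
      using \<open>d \<noteq> 0\<close> \<open>y \<noteq> 0\<close> by (simp add: Fract_conv_to_fract)
    then have "to_fract d * (g * to_fract (x ^ n)) = to_fract c * to_fract (y ^ n)"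
      using \<open>d \<noteq> 0\<close> \<open>y \<noteq> 0\<close> by (simp add: field_simps del: to_fract_mult)
    then have "to_fract d * Fract (a * x ^ n) b = to_fract (c * y ^ n)" unfolding h by simp
    then have "d \<in> colon (Fract (a * x ^ n) b)" unfolding colon_def mem_Collect_eq by (rule range_eqI)
    then show ?thesis using cd by blast
  qed
  then have "Fract (a * x ^ n) b \<in> range to_fract"
    by (rule in_ring_if_locally_in_ring[OF noeth normal dim x deg ab(2,3)])
  then obtain r where r: "Fract (a * x ^ n) b = to_fract r" by blast
  have "r \<in> G n" by (rule degree_of_homogeneous_fraction[OF deg ab(2,3) r])
  moreover have "g = Fract r (x ^ n)"
    using r x_power(2)[of n] unfolding h by (simp add: Fract_conv_to_fract field_simps)
  ultimately show ?thesis using that g(2) by blast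
qed

subsection \<open>The divisor is Cartier and ample\<close>

lemma quotient_is_section:
  assumes "y \<in> G 1" "z \<in> G 1"
  shows "(\<lambda>p\<in>basic_open y \<inter> basic_open z. Fract y z) \<in> Proj_sections (basic_open y \<inter> basic_open z)"
proof (rule global_fraction_in_Proj_sections[OF _ assms])
  show "openin (Proj_topology G) (basic_open y \<inter> basic_open z)" by (simp add: openin_Int)
qed (auto simp: basic_open_def)

lemma cartier_divisor_hyperplane: "cartier_divisor (Proj G) hyperplane_divisor"
  unfolding cartier_divisor_def
proof (intro conjI)
  have "(\<lambda>p\<in>basic_open y. Fract x y) \<in> rational_sections (Proj G) (basic_open y)"
    if "y \<in> G 1" "y \<noteq> 0" for y
    by (rule constant_rational_section[OF openin_basic_open function_field_ProjI[OF generic x(1) that]])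
  moreover have "Fract x y \<noteq> 0" if "y \<noteq> 0" for y
    using that x by (simp add: Zero_fract_def eq_fract)
  ultimately show "\<forall>(U, f)\<in>hyperplane_divisor. openin (top_of (Proj G)) U \<and>
      f \<in> rational_sections (Proj G) U \<and> (\<forall>p\<in>U. f p \<noteq> 0)"
    unfolding hyperplane_divisor_def by auto
next
  show "(\<Union>(U, f)\<in>hyperplane_divisor. U) = topspace (top_of (Proj G))"
  proof (intro equalityI subsetI)
    fix P assume "P \<in> topspace (top_of (Proj G))"
    then have P: "P \<in> Proj_points G" by simp
    obtain y where "y \<in> G 1" "y \<notin> P" using degree_one_notin_Proj_point[OF fin P] by blast
    then have "y \<noteq> 0" using Proj_zero[OF P] by blast
    then have "(basic_open y, \<lambda>p\<in>basic_open y. Fract x y) \<in> hyperplane_divisor"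
      unfolding hyperplane_divisor_def using \<open>y \<in> G 1\<close> by blast
    then show "P \<in> (\<Union>(U, f)\<in>hyperplane_divisor. U)"
      by (rule UN_I) (use P \<open>y \<notin> P\<close> in \<open>simp add: basic_open_def\<close>)
  qed (auto simp: hyperplane_divisor_def basic_open_def)
next
  have "(\<lambda>p\<in>basic_open y \<inter> basic_open z. (\<lambda>p\<in>basic_open y. Fract x y) p / (\<lambda>p\<in>basic_open z. Fract x z) p)
      \<in> Units (sheaf_of (Proj G) (basic_open y \<inter> basic_open z))"
    if yz: "y \<in> G 1" "y \<noteq> 0" "z \<in> G 1" "z \<noteq> 0" for y z
  proof -
    let ?U = "basic_open y \<inter> basic_open z"
    have "(\<lambda>p\<in>?U. (\<lambda>p\<in>basic_open y. Fract x y) p / (\<lambda>p\<in>basic_open z. Fract x z) p) = (\<lambda>p\<in>?U. Fract z y)"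
      by (rule restrict_ext) (use x yz in \<open>auto simp: eq_fract\<close>)
    moreover have "(\<lambda>p\<in>?U. Fract z y) \<in> Proj_sections ?U" "(\<lambda>p\<in>?U. Fract y z) \<in> Proj_sections ?U"
      using quotient_is_section yz by (metis Int_commute)+
    moreover have "Fract z y * Fract y z = 1" using yz by (simp add: One_fract_def eq_fract)
    ultimately show ?thesis
      unfolding Units_def
      by (auto simp: sheaf_of_Proj function_ring_def mult.commute intro!: bexI[of _ "\<lambda>p\<in>?U. Fract y z"] restrict_ext)
  qed
  then show "\<forall>(U, f)\<in>hyperplane_divisor. \<forall>(V, g)\<in>hyperplane_divisor.
      (\<lambda>p\<in>U \<inter> V. f p / g p) \<in> Units (sheaf_of (Proj G) (U \<inter> V))"
    unfolding hyperplane_divisor_def by auto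
qed

text \<open>On \<open>basic_open y\<close> the section \<open>y / x\<close> generates the sheaf of \<open>D\<close>. Where \<open>y\<close> vanishes but
  \<open>z\<close> does not, it is the generator \<open>z / x\<close> times the nonunit \<open>y / z\<close>.\<close>

lemma nonvanishing_locus_degree_one:
  assumes y: "y \<in> G 1" "y \<noteq> 0"
  shows "nonvanishing_locus (Proj G) (mult_divisor 1) (\<lambda>p\<in>Proj_points G. Fract y (x ^ 1)) = basic_open y"
    (is "?N = _")
proof (intro equalityI subsetI)
  fix p assume p: "p \<in> basic_open y"
  then have pp: "p \<in> Proj_points G" by (simp add: basic_open_def)
  have "Fract y (x ^ 1) \<noteq> a * b"
    if a: "a \<in> stalk_maximal_ideal (Proj G) p" and b: "b \<in> divisor_stalk (Proj G) (mult_divisor 1) p" for a b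
  proof
    assume eq: "Fract y (x ^ 1) = a * b"
    obtain t V where t: "b = t p" "openin (Proj_topology G) V" "p \<in> V"
      "t \<in> divisor_sections (Proj G) (mult_divisor 1) V"
      using b by (auto simp: divisor_stalk_def)
    have "(\<lambda>p\<in>basic_open y \<inter> V. t p * Fract (x ^ 1) (y ^ 1)) \<in> Proj_sections (basic_open y \<inter> V)"
      using t(4) y unfolding divisor_sections_iff by blast
    moreover have "openin (Proj_topology G) (basic_open y \<inter> V)" using t(2) by (simp add: openin_Int)
    moreover have pV: "p \<in> basic_open y \<inter> V" using p t(3) by blast
    ultimately have "(\<lambda>p\<in>basic_open y \<inter> V. t p * Fract (x ^ 1) (y ^ 1)) p \<in> stalk (Proj G) p"
      unfolding stalk_def mem_Collect_eq top_of_Proj carrier_sheaf_of_Proj by blast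
    then have "b * Fract (x ^ 1) (y ^ 1) \<in> stalk (Proj G) p" using pV t(1) by simp
    moreover have "a * (b * Fract (x ^ 1) (y ^ 1)) = 1"
    proof -
      have "a * (b * Fract (x ^ 1) (y ^ 1)) = Fract y (x ^ 1) * Fract (x ^ 1) (y ^ 1)"
        unfolding eq by (simp only: ac_simps)
      also have "\<dots> = 1" using x y by (simp add: One_fract_def eq_fract)
      finally show ?thesis .
    qed
    ultimately show False using a by (auto simp: stalk_maximal_ideal_def)
  qed
  then show "p \<in> ?N" using pp unfolding nonvanishing_locus_def by auto
next
  fix p assume pN: "p \<in> ?N"
  then have p: "p \<in> Proj_points G" by (simp add: nonvanishing_locus_def)
  show "p \<in> basic_open y"
  proof (rule ccontr)
    assume "p \<notin> basic_open y"
    then have yp: "y \<in> p" using p by (simp add: basic_open_def)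
    obtain z where z: "z \<in> G 1" "z \<notin> p" using degree_one_notin_Proj_point[OF fin p] by blast
    then have "z \<noteq> 0" using Proj_zero[OF p] by blast
    have "Fract y z \<in> stalk_maximal_ideal (Proj G) p"
      unfolding stalk_maximal_ideal_def
    proof (intro CollectI conjI ballI notI)
      show "Fract y z \<in> stalk (Proj G) p" by (rule stalk_ProjI[OF p y(1) z])
      fix w assume "w \<in> stalk (Proj G) p" and w: "Fract y z * w = 1"
      then obtain c d where cd: "d \<notin> p" "w = Fract c d" using stalk_ProjE by metis
      have "d \<noteq> 0" using cd(1) Proj_zero[OF p] by blast
      then have "y * c = z * d" using w \<open>z \<noteq> 0\<close> unfolding cd(2) by (simp add: One_fract_def eq_fract)
      then have "z * d \<in> p" using ideal_mult_right[OF Proj_ideal[OF p] yp] by metis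
      then show False using Proj_mult_notin[OF p z(2) cd(1)] by blast
    qed
    moreover have "Fract z (x ^ 1) \<in> divisor_stalk (Proj G) (mult_divisor 1) p"
      unfolding divisor_stalk_def mem_Collect_eq
      using global_section_fraction[OF z(1)] p openin_topspace[of "Proj_topology G"]
      by (intro exI[of _ "\<lambda>p\<in>Proj_points G. Fract z (x ^ 1)"] exI[of _ "Proj_points G"]) simp
    moreover have "Fract y (x ^ 1) = Fract y z * Fract z (x ^ 1)"
      using x \<open>z \<noteq> 0\<close> by (simp add: eq_fract)
    moreover have "(\<lambda>p\<in>Proj_points G. Fract y (x ^ 1)) p = Fract y (x ^ 1)" using p by simp
    ultimately have "(\<lambda>p\<in>Proj_points G. Fract y (x ^ 1)) p \<in>
        {a * b |a b. a \<in> stalk_maximal_ideal (Proj G) p \<and> b \<in> divisor_stalk (Proj G) (mult_divisor 1) p}"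
      unfolding mem_Collect_eq by metis
    then show False using pN unfolding nonvanishing_locus_def by blast
  qed
qed

lemma ample_hyperplane: "ample (Proj G) hyperplane_divisor"
  unfolding ample_def
proof (intro conjI ballI)
  show "compact_space (top_of (Proj G))" using compact_space_Proj[OF noeth] by simp
  fix p assume "p \<in> topspace (top_of (Proj G))"
  then have p: "p \<in> Proj_points G" by simp
  obtain y where y: "y \<in> G 1" "y \<notin> p" using degree_one_notin_Proj_point[OF fin p] by blast
  then have "y \<noteq> 0" using Proj_zero[OF p] by blast
  let ?s = "\<lambda>p\<in>Proj_points G. Fract y (x ^ 1)"
  have "?s \<in> global_sections (Proj G) (mult_divisor 1)" by (rule global_section_fraction[OF y(1)])
  moreover note nonvanishing_locus_degree_one[OF y(1) \<open>y \<noteq> 0\<close>]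
  moreover have "p \<in> basic_open y" using p y(2) by (simp add: basic_open_def)
  moreover note affine_open_basic_open[OF y(1) \<open>y \<noteq> 0\<close>]
  ultimately show "\<exists>n\<ge>1. \<exists>s\<in>global_sections (Proj G) (mult_divisor n).
      p \<in> nonvanishing_locus (Proj G) (mult_divisor n) s \<and>
      affine_open (Proj G) (nonvanishing_locus (Proj G) (mult_divisor n) s)"
    by (intro exI[of _ 1] conjI bexI[of _ ?s]) simp_all
qed

subsection \<open>The section ring\<close>

definition to_sections :: "'a \<Rightarrow> nat \<Rightarrow> 'a set \<Rightarrow> 'a fract" where
  "to_sections r = (\<lambda>n. \<lambda>p\<in>Proj_points G. Fract (component n r) (x ^ n))"

lemma Fract_x_power_eq_iff: "Fract a (x ^ n) = Fract b (x ^ n) \<longleftrightarrow> a = b"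
  using x(2) by (simp add: eq_fract)

lemma section_eq_iff:
  "(\<lambda>p\<in>Proj_points G. Fract a (x ^ n)) = (\<lambda>p\<in>Proj_points G. Fract b (x ^ n)) \<longleftrightarrow> a = b"
proof
  assume "(\<lambda>p\<in>Proj_points G. Fract a (x ^ n)) = (\<lambda>p\<in>Proj_points G. Fract b (x ^ n))"
  from fun_cong[OF this, of "{0}"] show "a = b" using generic by (simp add: Fract_x_power_eq_iff)
qed simp

lemma zero_section: "(\<lambda>p\<in>Proj_points G. 0) = (\<lambda>p\<in>Proj_points G. Fract 0 (x ^ n))"
proof -
  have "Fract 0 (x ^ n) = 0" using x(2) by (simp add: Zero_fract_def eq_fract)
  then show ?thesis by simp
qed

lemma to_sections_eq_zero_iff: "to_sections r n = (\<lambda>p\<in>Proj_points G. 0) \<longleftrightarrow> component n r = 0"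
  unfolding to_sections_def zero_section[of n] by (rule section_eq_iff)

lemma to_sections_carrier: "to_sections r \<in> carrier (section_ring (Proj G) hyperplane_divisor)"
proof -
  have "to_sections r n \<in> global_sections (Proj G) (mult_divisor n)" for n
    unfolding to_sections_def by (rule global_section_fraction[OF component_in])
  moreover have "finite {n. to_sections r n \<noteq> (\<lambda>p\<in>Proj_points G. 0)}"
    unfolding to_sections_eq_zero_iff by (rule finite_comp)
  ultimately show ?thesis by (simp add: section_ring_def Let_def)
qed

lemma to_sections_surj:
  assumes c: "c \<in> carrier (section_ring (Proj G) hyperplane_divisor)"
  obtains r where "c = to_sections r"
proof -
  have c': "c n \<in> global_sections (Proj G) (mult_divisor n)"
    "finite {n. c n \<noteq> (\<lambda>p\<in>Proj_points G. 0)}" for n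
    using c by (simp_all add: section_ring_def Let_def)
  have "\<forall>n. \<exists>r. r \<in> G n \<and> c n = (\<lambda>p\<in>Proj_points G. Fract r (x ^ n))"
    using global_section_is_fraction[OF c'(1)] by metis
  then obtain r where r: "\<And>n. r n \<in> G n" "\<And>n. c n = (\<lambda>p\<in>Proj_points G. Fract (r n) (x ^ n))"
    by metis
  have "c n = (\<lambda>p\<in>Proj_points G. 0) \<longleftrightarrow> r n = 0" for n
    unfolding r(2) zero_section[of n] by (rule section_eq_iff)
  then have fin: "finite {n. r n \<noteq> 0}" using c'(2) by simp
  have "component n (\<Sum>n | r n \<noteq> 0. r n) = r n" for n
    by (rule component_unique[OF r(1) fin _ refl]) simp
  then have "c = to_sections (\<Sum>n | r n \<noteq> 0. r n)"
    unfolding to_sections_def by (intro ext) (simp add: r(2))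
  then show ?thesis by (rule that)
qed

lemma to_sections_ring_iso:
  "to_sections \<in> ring_iso (ring_on UNIV) (section_ring (Proj G) hyperplane_divisor)"
proof (rule ring_iso_memI)
  let ?S = "section_ring (Proj G) hyperplane_divisor"
  show "bij_betw to_sections (carrier (ring_on UNIV)) (carrier ?S)"
  proof (rule bij_betw_imageI)
    show "inj_on to_sections (carrier (ring_on UNIV))"
    proof (rule inj_onI)
      fix r s assume "to_sections r = to_sections s"
      then have "to_sections r n = to_sections s n" for n by simp
      then have "component n r = component n s" for n unfolding to_sections_def section_eq_iff .
      then show "r = s" by (rule component_eqI)
    qed
    show "to_sections ` carrier (ring_on UNIV) = carrier ?S"
      using to_sections_carrier to_sections_surj by (auto simp: image_iff) metis
  qed
  fix r s :: 'a
  show "to_sections r \<in> carrier ?S" by (rule to_sections_carrier)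
  have "Fract (component n (r * s)) (x ^ n) =
      (\<Sum>i\<le>n. Fract (component i r) (x ^ i) * Fract (component (n - i) s) (x ^ (n - i)))" for n
  proof -
    have "(\<Sum>i\<le>n. Fract (component i r) (x ^ i) * Fract (component (n - i) s) (x ^ (n - i))) =
        (\<Sum>i\<le>n. to_fract (component i r * component (n - i) s) / to_fract (x ^ n))"
    proof (rule sum.cong[OF refl])
      fix i assume "i \<in> {..n}"
      then have "x ^ i * x ^ (n - i) = x ^ n" by (simp add: power_add[symmetric])
      then show "Fract (component i r) (x ^ i) * Fract (component (n - i) s) (x ^ (n - i)) =
          to_fract (component i r * component (n - i) s) / to_fract (x ^ n)"
        by (simp add: to_fract_def del: to_fract_mult)
    qed
    also have "\<dots> = to_fract (component n (r * s)) / to_fract (x ^ n)"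
    proof -
      have "to_fract (sum f N) = (\<Sum>i\<in>N. to_fract (f i))" for f :: "nat \<Rightarrow> 'a" and N
        by (induction N rule: infinite_finite_induct) auto
      then show ?thesis unfolding component_mult by (simp add: sum_divide_distrib)
    qed
    finally show ?thesis using x_power(2)[of n] by (simp add: Fract_conv_to_fract)
  qed
  then show "to_sections (r \<otimes>\<^bsub>ring_on UNIV\<^esub> s) = to_sections r \<otimes>\<^bsub>?S\<^esub> to_sections s"
    by (simp add: section_ring_def Let_def to_sections_def fun_eq_iff)
  have "Fract (component n (r + s)) (x ^ n) = Fract (component n r) (x ^ n) + Fract (component n s) (x ^ n)" for n
    using x_power(2)[of n] by (simp add: component_add Fract_conv_to_fract add_divide_distrib)
  then show "to_sections (r \<oplus>\<^bsub>ring_on UNIV\<^esub> s) = to_sections r \<oplus>\<^bsub>?S\<^esub> to_sections s"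
    by (simp add: section_ring_def Let_def to_sections_def fun_eq_iff)
next
  have "Fract (component n 1) (x ^ n) = (if n = 0 then 1 else 0)" for n
    using x_power(2)[of n] by (simp add: component_homogeneous[OF G_one] Fract_conv_to_fract)
  then show "to_sections \<one>\<^bsub>ring_on UNIV\<^esub> = \<one>\<^bsub>section_ring (Proj G) hyperplane_divisor\<^esub>"
    by (simp add: section_ring_def Let_def to_sections_def)
qed

lemma to_sections_degree: "to_sections ` G n = section_ring_degree (Proj G) hyperplane_divisor n"
proof (intro equalityI subsetI)
  fix c assume "c \<in> to_sections ` G n"
  then obtain r where r: "r \<in> G n" "c = to_sections r" by blast
  then have "component m r = 0" if "m \<noteq> n" for m using that by (simp add: component_homogeneous)
  then show "c \<in> section_ring_degree (Proj G) hyperplane_divisor n"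
    using to_sections_carrier by (simp add: section_ring_degree_def r(2) to_sections_eq_zero_iff)
next
  fix c assume c: "c \<in> section_ring_degree (Proj G) hyperplane_divisor n"
  then obtain r where r: "c = to_sections r" using to_sections_surj by (auto simp: section_ring_degree_def)
  then have "component m r = 0" if "m \<noteq> n" for m
    using c that by (simp add: section_ring_degree_def to_sections_eq_zero_iff)
  then have "r \<in> G n" by (rule homogeneous_if_comp)
  then show "c \<in> to_sections ` G n" using r by blast
qed

end

theorem theorem3:
  fixes G :: "nat \<Rightarrow> 'a::idom set"
  assumes "graded_ring G"
    and "noetherian_ring (ring_on (UNIV :: 'a set))"
    and "normal_domain TYPE('a)"
    and "subfield (G 0) (ring_on UNIV)"
    and "2 \<le> krull_dim (ring_on (UNIV :: 'a set))"
    and "module_finite_over (degree_one_subalgebra G)"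
  shows "\<exists>D. cartier_divisor (Proj G) D \<and> ample (Proj G) D \<and>
    (\<exists>\<phi> \<in> ring_iso (ring_on UNIV) (section_ring (Proj G) D).
       \<forall>n. \<phi> ` G n = section_ring_degree (Proj G) D n)"
proof -
  interpret graded_domain G by (rule graded_domain.intro) (fact assms)+
  obtain x where x: "x \<in> G 1" "x \<noteq> 0" by (rule degree_one_nontrivial[OF assms(6,5)])
  interpret section_ring_setting G x
    by (intro section_ring_setting.intro graded_domain_axioms section_ring_setting_axioms.intro)
      (fact x assms)+
  show ?thesis
    using cartier_divisor_hyperplane ample_hyperplane to_sections_ring_iso to_sections_degree by blast
qed

end
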